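(* Let $D^2=\{z=(z_1,z_2)\in\mathbf{C}^2:\ \operatorname{Im} z_2>\tfrac12|z_1|^2\}$. Define holomorphic automorphisms $G_1,\dots,G_8$ of $D^2$ by $$G_1(z_1,z_2)=J(z_1,z_2)=\left(\frac{iz_1}{z_2},-\frac1{z_2}\right),$$ $$G_{r+3}=J\circ N_{(1+i,\,r+i)}\circ M_{-1},\qquad r=-1,0,1,$$ $$G_{5+\frac{1+r}2}=N_{(1,\frac{r+i}2)}\circ J\circ N_{(-1+ri,\,r+i)}\circ A_{\sqrt2}\circ M_{\frac{-1+ri}{\sqrt2}},\qquad r=-1,1,$$ $$G_{7+\frac{1+r}2}=N_{(i,\frac{r+i}2)}\circ J\circ N_{(-r-i,\,r+i)}\circ A_{\sqrt2}\circ M_{\frac{-1+ri}{\sqrt2}},\qquad r=-1,1.$$ Then $G_1,\dots,G_8$ belong to the Picard modular group $\Gamma$; $G_1,\dots,G_4$ have dilation parameter $1$ and $G_5,\dots,G_8$ have dilation parameter $\sqrt2$; and the set \begin{align*} \mathcal F=\{z\in D^2:\ & 0\le\operatorname{Re} z_1,\ 0\le\operatorname{Im} z_1,\ \operatorname{Re} z_1+\operatorname{Im} z_1\le 1,\ |\operatorname{Re} z_2|\le\tfrac12,\\ & |z_2|^2\ge1,\ |\det G_j'(z)|^2\le1,\ j=2,\dots,8\} \end{align*} is a fundamental domain of the Picard modular group $\Gamma$ acting on $D^2$ (the hyperquadric model of $\mathbf{CH}^2$). All eight transformations are needed: if the condition belonging to any one of $G_1,\dots,G_8$ is omitted from the description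 of $\mathcal F$ (the condition belonging to $G_1$ being $|z_2|^2\ge1$), the resulting set is strictly larger than $\mathcal F$.
   Context: Picard modular group: $\Gamma=\{A\in SL(3,\mathbf C):\ A^*CA=C,\ a_{jk}\in\mathbf Z[i]\}$, where $C=\begin{pmatrix}0&0&i\\0&1&0\\-i&0&0\end{pmatrix}$ and $A^*$ is the conjugate transpose. A matrix $G=[g_{jk}]$ with $A=G$ satisfying $A^*CA=C$ acts on $D^2$ by $$G(z)=\left(\frac{g_{21}+g_{22}z_1+g_{23}z_2}{g_{11}+g_{12}z_1+g_{13}z_2},\ \frac{g_{31}+g_{32}z_1+g_{33}z_2}{g_{11}+g_{12}z_1+g_{13}z_2}\right),$$ and an automorphism of $D^2$ is said to be in $\Gamma$ if it is given by a matrix in $\Gamma$. $\det G'(z)$ denotes the complex Jacobian determinant of the map $G$ at $z$. The dilation parameter of an automorphism $G=[g_{jk}]\in\Gamma$ not fixing $\infty$ (i.e. with $g_{13}\ne0$) is $\delta=|g_{13}|$. Heisenberg translations: for $a=(a_1,a_2)\in\partial D^2$ (i.e. $\operatorname{Im}a_2=\frac12|a_1|^2$), $N_a(z_1,z_2)=(z_1+a_1,\ z_2+a_2+iz_1\bar a_1)$. Dilations: for $\delta>0$, $A_\delta(z_1,z_2)=(\delta z_1,\delta^2z_2)$. Rotations: for $\beta\in\mathbf C$ with $|\beta|=1$, $M_\beta$ is the automorphism with matrix $\operatorname{diag}(\beta,\beta^{-2},\beta)$, i.e. $M_\beta(z_1,z_2)=(\beta^{-3}z_1,z_2)$. Fundamental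 domain: a set $\mathcal F\subset D^2$ is a fundamental domain for $\Gamma$ if (i) for every $z\in D^2$ there is $G\in\Gamma$ with $G(z)\in\mathcal F$; and (ii) whenever $z\in\mathcal F$ and $G(z)\in\mathcal F$ for some $G\in\Gamma\setminus\{I\}$, then $z$ lies on the (topological) boundary of $\mathcal F$. *)

theory Defs
  imports "HOL-Analysis.Analysis"
begin

definition D2 :: "(complex^2) set" where
  "D2 = {z. Im (z$2) > (cmod (z$1))^2 / 2}"

definition conj_transpose :: "complex^'n^'m \<Rightarrow> complex^'m^'n" where
  "conj_transpose A = (\<chi> i j. cnj (A$j$i))"

definition C_form :: "complex^3^3" where
  "C_form = vector [vector [0, 0, \<i>],
                    vector [0, 1, 0],
                    vector [-\<i>, 0, 0]]"

definition gaussian_integers :: "complex set" where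
  "gaussian_integers = {x. Re x \<in> \<int> \<and> Im x \<in> \<int>}"

definition picard_group :: "(complex^3^3) set" where
  "picard_group = {A. det A = 1 \<and> conj_transpose A ** C_form ** A = C_form
                      \<and> (\<forall>j k. A$j$k \<in> gaussian_integers)}"

text \<open>The projective action of a matrix on the homogeneous column vector \<open>(1, z1, z2)\<close>.\<close>

definition act :: "complex^3^3 \<Rightarrow> complex^2 \<Rightarrow> complex^2" where
  "act G z = vector
     [(G$2$1 + G$2$2 * z$1 + G$2$3 * z$2) / (G$1$1 + G$1$2 * z$1 + G$1$3 * z$2),
      (G$3$1 + G$3$2 * z$1 + G$3$3 * z$2) / (G$1$1 + G$1$2 * z$1 + G$1$3 * z$2)]"

text \<open>Complex differentiability in two variables: the real Frechet derivative is given by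
  multiplication with a complex matrix.\<close>

definition holo_on :: "(complex^2 \<Rightarrow> complex^2) \<Rightarrow> (complex^2) set \<Rightarrow> bool" where
  "holo_on f S \<longleftrightarrow> (\<forall>z\<in>S. \<exists>L :: complex^2^2. (f has_derivative (\<lambda>h. L *v h)) (at z within S))"

definition D2_automorphism :: "(complex^2 \<Rightarrow> complex^2) \<Rightarrow> bool" where
  "D2_automorphism f \<longleftrightarrow> bij_betw f D2 D2 \<and> holo_on f D2 \<and> holo_on (inv_into D2 f) D2"

text \<open>Automorphisms are represented by total functions on \<open>complex^2\<close>; only their values
  on \<^const>\<open>D2\<close> matter.\<close>

definition given_by :: "(complex^2 \<Rightarrow> complex^2) \<Rightarrow> complex^3^3 \<Rightarrow> bool" where
  "given_by f A \<longleftrightarrow> (\<forall>z\<in>D2. f z = act A z)"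

definition in_picard :: "(complex^2 \<Rightarrow> complex^2) \<Rightarrow> bool" where
  "in_picard f \<longleftrightarrow> D2_automorphism f \<and> (\<exists>A\<in>picard_group. given_by f A)"

text \<open>The dilation parameter is read off from the matrix in \<^const>\<open>picard_group\<close> giving \<open>f\<close>.
  That matrix is unique; to avoid relying on this, the condition is
  required of every such matrix.\<close>

definition has_dilation_parameter :: "(complex^2 \<Rightarrow> complex^2) \<Rightarrow> real \<Rightarrow> bool" where
  "has_dilation_parameter f \<delta> \<longleftrightarrow> in_picard f \<and>
     (\<forall>A\<in>picard_group. given_by f A \<longrightarrow> A$1$3 \<noteq> 0 \<and> cmod (A$1$3) = \<delta>)"

text \<open>The generating automorphisms. The map \<open>heis_trans a\<close> is an automorphism of
  \<^const>\<open>D2\<close> only for \<open>a\<close> on the boundary of \<^const>\<open>D2\<close>,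
  \<open>dilation \<delta>\<close> only for \<open>\<delta> > 0\<close>, and \<open>rotation \<beta>\<close> only for \<open>cmod \<beta> = 1\<close>.\<close>

definition heis_trans :: "complex^2 \<Rightarrow> complex^2 \<Rightarrow> complex^2" where
  "heis_trans a z = vector [z$1 + a$1, z$2 + a$2 + \<i> * z$1 * cnj (a$1)]"

definition dilation :: "real \<Rightarrow> complex^2 \<Rightarrow> complex^2" where
  "dilation \<delta> z = vector [of_real \<delta> * z$1, of_real (\<delta>^2) * z$2]"

definition rotation :: "complex \<Rightarrow> complex^2 \<Rightarrow> complex^2" where
  "rotation \<beta> = act (vector [vector [\<beta>, 0, 0],
                            vector [0, inverse (\<beta>^2), 0],
                            vector [0, 0, \<beta>]])"

lemma rotation_eq: "\<beta> \<noteq> 0 \<Longrightarrow> rotation \<beta> z = vector [inverse (\<beta>^3) * z$1, z$2]"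
  by (simp add: rotation_def act_def vec_eq_iff forall_2 field_simps
      power2_eq_square power3_eq_cube)

definition J :: "complex^2 \<Rightarrow> complex^2" where
  "J z = vector [\<i> * z$1 / z$2, - 1 / z$2]"

definition G_first :: "int \<Rightarrow> complex^2 \<Rightarrow> complex^2" where
  "G_first r = J \<circ> heis_trans (vector [1 + \<i>, of_int r + \<i>]) \<circ> rotation (-1)"

definition G_second :: "int \<Rightarrow> complex^2 \<Rightarrow> complex^2" where
  "G_second r = heis_trans (vector [1, (of_int r + \<i>) / 2]) \<circ> J
     \<circ> heis_trans (vector [-1 + of_int r * \<i>, of_int r + \<i>])
     \<circ> dilation (sqrt 2) \<circ> rotation ((-1 + of_int r * \<i>) / of_real (sqrt 2))"

definition G_third :: "int \<Rightarrow> complex^2 \<Rightarrow> complex^2" where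
  "G_third r = heis_trans (vector [\<i>, (of_int r + \<i>) / 2]) \<circ> J
     \<circ> heis_trans (vector [- of_int r - \<i>, of_int r + \<i>])
     \<circ> dilation (sqrt 2) \<circ> rotation ((-1 + of_int r * \<i>) / of_real (sqrt 2))"

text \<open>\<open>G j\<close> is meaningful for \<open>1 \<le> j \<le> 8\<close> only.\<close>

definition G :: "nat \<Rightarrow> complex^2 \<Rightarrow> complex^2" where
  "G j = [J, G_first (-1), G_first 0, G_first 1,
          G_second (-1), G_second 1, G_third (-1), G_third 1] ! (j - 1)"

text \<open>For holomorphic \<open>f\<close> the library's \<^const>\<open>jacobian\<close> (the matrix, over the scalar field
  \<^typ>\<open>complex\<close>, of the Frechet derivative) is the matrix of complex partial derivatives.\<close>

definition complex_jacobian_det :: "(complex^2 \<Rightarrow> complex^2) \<Rightarrow> complex^2 \<Rightarrow> complex" where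
  "complex_jacobian_det f z = det (jacobian f (at z) :: complex^2^2)"

definition G_condition :: "nat \<Rightarrow> complex^2 \<Rightarrow> bool" where
  "G_condition j z \<longleftrightarrow> (if j = 1 then (cmod (z$2))^2 \<ge> 1
                        else (cmod (complex_jacobian_det (G j) z))^2 \<le> 1)"

text \<open>The set cut out by the conditions belonging to the indices in \<open>S\<close>; the domain of
  interest is \<open>picard_region {1..8}\<close>.\<close>

definition picard_region :: "nat set \<Rightarrow> (complex^2) set" where
  "picard_region S = {z\<in>D2. 0 \<le> Re (z$1) \<and> 0 \<le> Im (z$1) \<and> Re (z$1) + Im (z$1) \<le> 1
                        \<and> \<bar>Re (z$2)\<bar> \<le> 1/2 \<and> (\<forall>j\<in>S. G_condition j z)}"

text \<open>Since \<^const>\<open>D2\<close> is open, a point of \<open>F \<subseteq> D2\<close> is a boundary point of \<open>F\<close> in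
  \<^const>\<open>D2\<close> iff it is one in the whole space, so \<^const>\<open>frontier\<close> is unambiguous here.\<close>

definition fundamental_domain :: "(complex^3^3) set \<Rightarrow> (complex^2) set \<Rightarrow> bool" where
  "fundamental_domain \<Gamma> F \<longleftrightarrow> F \<subseteq> D2
     \<and> (\<forall>z\<in>D2. \<exists>A\<in>\<Gamma>. act A z \<in> F)
     \<and> (\<forall>z\<in>F. \<forall>A\<in>\<Gamma> - {mat 1}. act A z \<in> F \<longrightarrow> z \<in> frontier F)"

end

theory Submission
  imports Defs
begin

text \<open>
  Write \<open>denom A z = a\<^sub>1\<^sub>1 + a\<^sub>1\<^sub>2 z\<^sub>1 + a\<^sub>1\<^sub>3 z\<^sub>2\<close> and \<open>height z = Im z\<^sub>2 - \<bar>z\<^sub>1\<bar>\<^sup>2 / 2\<close>. Then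
  \<open>height (A z) = height z / \<bar>denom A z\<bar>\<^sup>2\<close> and \<open>det A'(z) = 1 / (denom A z)\<^sup>3\<close>, so the region is a
  truncated Ford domain. Every orbit contains a point of maximal height; moving it by the stabilizer
  of infinity into the given prism yields a point of the region. Conversely, on the region the
  height is at least \<open>1/2\<close>, and since \<open>\<bar>denom A z\<bar> \<ge> \<bar>a\<^sub>1\<^sub>3\<bar> height z\<close>, only matrices with
  \<open>\<bar>a\<^sub>1\<^sub>3\<bar>\<^sup>2 \<in> {1, 2}\<close> can have a denominator of modulus less than 1. The first row of such a matrix
  is a null vector of Gaussian integers, and its isometric sphere can meet the prism only if its
  centre lies over one of the points \<open>0, 1, \<i>, 1 + \<i>\<close>, where it is dominated by the spheres of
  the eight given transformations. Hence
  \<open>\<bar>denom A z\<bar> \<ge> 1\<close> on the region for all \<open>A\<close> in the group. If \<open>z\<close> and \<open>A z\<close> both lie in the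
  region, applying this to \<open>A\<close> and its inverse gives \<open>\<bar>denom A z\<bar> = 1\<close>, which is impossible at an
  interior point because \<open>denom A\<close> is affine, unless \<open>A\<close> fixes infinity.
\<close>


section \<open>Gaussian integers and the group structure of \<open>picard_group\<close>\<close>

lemma gaussian_integers_closed [simp, intro]:
  "0 \<in> gaussian_integers" "1 \<in> gaussian_integers" "\<i> \<in> gaussian_integers"
  "of_int k \<in> gaussian_integers"
  "x \<in> gaussian_integers \<Longrightarrow> - x \<in> gaussian_integers"
  "x \<in> gaussian_integers \<Longrightarrow> cnj x \<in> gaussian_integers"
  "x \<in> gaussian_integers \<Longrightarrow> y \<in> gaussian_integers \<Longrightarrow> x + y \<in> gaussian_integers"
  "x \<in> gaussian_integers \<Longrightarrow> y \<in> gaussian_integers \<Longrightarrow> x - y \<in> gaussian_integers"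
  "x \<in> gaussian_integers \<Longrightarrow> y \<in> gaussian_integers \<Longrightarrow> x * y \<in> gaussian_integers"
  by (auto simp: gaussian_integers_def)

lemma gaussian_integersE:
  assumes "x \<in> gaussian_integers"
  obtains m n :: int where "x = Complex (of_int m) (of_int n)"
  using assms by (force simp: gaussian_integers_def complex_eq_iff elim!: Ints_cases)

lemma sum_gaussian_integers:
  "(\<And>i. i \<in> S \<Longrightarrow> f i \<in> gaussian_integers) \<Longrightarrow> sum f S \<in> gaussian_integers"
  by (induction S rule: infinite_finite_induct) auto

lemma matrix_mult_gaussian_integers:
  fixes A B :: "complex^3^3"
  assumes "\<And>j k. A$j$k \<in> gaussian_integers" "\<And>j k. B$j$k \<in> gaussian_integers"
  shows "(A ** B)$j$k \<in> gaussian_integers"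
  using assms by (auto simp: matrix_matrix_mult_def intro!: sum_gaussian_integers)

lemma conj_transpose_mult: "conj_transpose (A ** B) = conj_transpose B ** conj_transpose A"
  by (simp add: conj_transpose_def matrix_matrix_mult_def vec_eq_iff mult.commute)

lemma conj_transpose_mat_1 [simp]: "conj_transpose (mat 1) = mat 1"
  by (simp add: conj_transpose_def mat_def vec_eq_iff)

lemma C_form_square: "C_form ** C_form = mat 1"
  by (simp add: C_form_def matrix_matrix_mult_def vec_eq_iff forall_3 sum_3 mat_def)

lemma C_form_gaussian_integers: "C_form$j$k \<in> gaussian_integers"
  using exhaust_3[of j] exhaust_3[of k] by (auto simp: C_form_def)

lemma picard_group_1: "mat 1 \<in> picard_group"
  by (auto simp: picard_group_def mat_def[of 1, symmetric]) (simp add: mat_def)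

lemma picard_group_mult:
  assumes "A \<in> picard_group" "B \<in> picard_group"
  shows "A ** B \<in> picard_group"
proof -
  have "conj_transpose (A ** B) ** C_form ** (A ** B)
      = conj_transpose B ** (conj_transpose A ** C_form ** A) ** B"
    by (simp only: conj_transpose_mult matrix_mul_assoc)
  then show ?thesis
    using assms matrix_mult_gaussian_integers[of A B] by (simp add: picard_group_def det_mul)
qed

text \<open>Since \<open>C_form\<close> squares to 1, the relation defining the group makes this
  product the inverse of \<open>A\<close>. In this form its entries are visibly Gaussian
  integers.\<close>

definition picard_inverse :: "complex^3^3 \<Rightarrow> complex^3^3" where
  "picard_inverse A = C_form ** conj_transpose A ** C_form"

lemma picard_inverse_left:
  assumes "A \<in> picard_group" shows "picard_inverse A ** A = mat 1"
proof -
  have "picard_inverse A ** A = C_form ** (conj_transpose A ** C_form ** A)"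
    by (simp only: picard_inverse_def matrix_mul_assoc)
  then show ?thesis using assms by (simp add: picard_group_def C_form_square)
qed

lemma picard_inverse_right:
  "A \<in> picard_group \<Longrightarrow> A ** picard_inverse A = mat 1"
  using picard_inverse_left matrix_left_right_inverse by metis

lemma picard_group_inverse:
  assumes A: "A \<in> picard_group" shows "picard_inverse A \<in> picard_group"
proof -
  let ?B = "picard_inverse A"
  have "det ?B * det A = 1"
    using picard_inverse_left[OF A] by (metis det_I det_mul)
  \<comment> \<open>Inserting the relation for \<open>A\<close> in the middle turns the form of
    \<open>?B\<close> into that of \<open>A ** ?B\<close>, which is \<open>mat 1\<close>.\<close>
  moreover have "conj_transpose ?B ** C_form ** ?B
      = conj_transpose ?B ** (conj_transpose A ** C_form ** A) ** ?B"
    using A by (simp add: picard_group_def)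
  then have "conj_transpose ?B ** C_form ** ?B
      = conj_transpose (A ** ?B) ** C_form ** (A ** ?B)"
    by (simp only: conj_transpose_mult matrix_mul_assoc)
  moreover have "?B$j$k \<in> gaussian_integers" for j k
    using A unfolding picard_inverse_def
    by (intro matrix_mult_gaussian_integers C_form_gaussian_integers)
       (auto simp: conj_transpose_def picard_group_def)
  ultimately show ?thesis
    using A picard_inverse_right[OF A] by (simp add: picard_group_def)
qed

text \<open>The explicit inverse gives the row version
  \<open>A ** C_form ** conj_transpose A = C_form\<close> of the defining relation. Its
  \<open>(1,1)\<close> entry says that the first row is a null vector; the estimates for
  denominators rest on this.\<close>

lemma picard_group_row_null:
  assumes A: "A \<in> picard_group"
  shows "(cmod (A$1$2))\<^sup>2 = 2 * Im (A$1$1 * cnj (A$1$3))"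
proof -
  have "A ** picard_inverse A = A ** C_form ** conj_transpose A ** C_form"
    by (simp only: picard_inverse_def matrix_mul_assoc)
  then have "A ** C_form ** conj_transpose A ** C_form = mat 1"
    using picard_inverse_right[OF A] by simp
  then have "A ** C_form ** conj_transpose A = C_form"
    by (metis C_form_square matrix_mul_assoc matrix_mul_rid matrix_mul_lid)
  then have "(A ** C_form ** conj_transpose A)$1$1 = 0"
    by (simp add: C_form_def)
  then have "Re ((A ** C_form ** conj_transpose A)$1$1) = 0"
    by simp
  then show ?thesis
    by (simp add: matrix_matrix_mult_def sum_3 C_form_def conj_transpose_def cmod_power2)
       (simp add: algebra_simps power2_eq_square)
qed

section \<open>The projective action and the height\<close>

definition hom_coord :: "complex^2 \<Rightarrow> complex^3" where
  "hom_coord z = vector [1, z$1, z$2]"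

definition denom :: "complex^3^3 \<Rightarrow> complex^2 \<Rightarrow> complex" where
  "denom A z = A$1$1 + A$1$2 * z$1 + A$1$3 * z$2"

definition height :: "complex^2 \<Rightarrow> real" where
  "height z = Im (z$2) - (cmod (z$1))\<^sup>2 / 2"

lemma D2_iff_height: "z \<in> D2 \<longleftrightarrow> height z > 0"
  by (simp add: D2_def height_def)

lemma hom_coord_nth [simp]:
  "hom_coord z $ 1 = 1" "hom_coord z $ 2 = z$1" "hom_coord z $ 3 = z$2"
  by (simp_all add: hom_coord_def)

lemma hom_coord_mult:
  "(A *v hom_coord z)$i = A$i$1 + A$i$2 * z$1 + A$i$3 * z$2"
  by (simp add: matrix_vector_mult_def sum_3)

lemma hom_coord_mult_1 [simp]: "(A *v hom_coord z)$1 = denom A z"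
  by (simp add: hom_coord_mult denom_def)

lemma act_nth:
  "act A z $ 1 = (A *v hom_coord z)$2 / denom A z"
  "act A z $ 2 = (A *v hom_coord z)$3 / denom A z"
  by (simp_all add: act_def hom_coord_mult denom_def)

lemma act_hom_coord:
  "denom A z \<noteq> 0 \<Longrightarrow> A *v hom_coord z = denom A z *s hom_coord (act A z)"
  by (simp add: vec_eq_iff forall_3 act_nth)

text \<open>The first entry of \<open>hom_coord\<close> is 1, so a homogeneous equation determines
  both the scalar and the point. The cocycle rule for \<open>denom\<close> thereby reduces to
  associativity of the matrix product.\<close>

lemma act_unique:
  assumes "A *v hom_coord z = c *s hom_coord w" "c \<noteq> 0"
  shows "denom A z = c" "act A z = w"
proof -
  have *: "(A *v hom_coord z)$i = c * hom_coord w $ i" for i using assms by simp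
  show c: "denom A z = c"
    using *[of 1] by simp
  show "act A z = w"
    using *[of 2] *[of 3] c assms(2)
    by (simp add: act_nth vec_eq_iff forall_2)
qed

lemma act_mult:
  assumes "denom B z \<noteq> 0" "denom A (act B z) \<noteq> 0"
  shows "denom (A ** B) z = denom B z * denom A (act B z)"
    and "act (A ** B) z = act A (act B z)"
proof -
  have "(A ** B) *v hom_coord z
      = (denom B z * denom A (act B z)) *s hom_coord (act A (act B z))"
    using act_hom_coord[OF assms(1)] act_hom_coord[OF assms(2)]
    by (simp add: matrix_vector_mul_assoc[symmetric] vec.scale)
  from act_unique[OF this] assms
  show "denom (A ** B) z = denom B z * denom A (act B z)"
    and "act (A ** B) z = act A (act B z)" by simp_all
qed

lemma act_mat_1 [simp]: "act (mat 1) z = z"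
  by (simp add: act_def mat_def vec_eq_iff forall_2)

section \<open>The invariant Hermitian form and the height\<close>

definition herm :: "complex^3 \<Rightarrow> complex^3 \<Rightarrow> complex" where
  "herm v w = (\<Sum>i\<in>UNIV. cnj (v$i) * w$i)"

lemma herm_adjoint: "herm (A *v v) w = herm v (conj_transpose A *v w)"
  unfolding herm_def conj_transpose_def matrix_vector_mult_def
  by (simp add: sum_distrib_left sum_distrib_right, subst sum.swap) (simp add: ac_simps)

lemma herm_C_form:
  "herm v (C_form *v v) = of_real ((cmod (v$2))\<^sup>2 - 2 * Im (cnj (v$1) * v$3))"
  by (simp add: herm_def sum_3 C_form_def matrix_vector_mult_def complex_eq_iff cmod_power2)
     (simp add: algebra_simps power2_eq_square)

lemma picard_herm_C_form:
  assumes "A \<in> picard_group"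
  shows "herm (A *v v) (C_form *v (A *v v)) = herm v (C_form *v v)"
  using assms
  by (simp add: herm_adjoint matrix_vector_mul_assoc matrix_mul_assoc picard_group_def)

text \<open>The invariant form of a lifted point is a multiple of its height, so invariance under
  \<open>A\<close> becomes the transformation law \<open>height_act\<close>.\<close>

lemma herm_hom_coord:
  "herm (c *s hom_coord z) (C_form *v (c *s hom_coord z)) = of_real (- 2 * (cmod c)\<^sup>2 * height z)"
proof -
  have "cnj c * (c * z$2) = of_real ((cmod c)\<^sup>2) * z$2"
    by (simp only: complex_norm_square mult.commute mult.assoc mult.left_commute)
  then have "Im (cnj c * (c * z$2)) = (cmod c)\<^sup>2 * Im (z$2)"
    by (simp only: Im_complex_of_real Re_complex_of_real times_complex.sel)
  then show ?thesis
    unfolding herm_C_form of_real_eq_iff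
    by (simp add: height_def norm_mult power_mult_distrib right_diff_distrib del: times_complex.sel)
qed

text \<open>A vector with first entry 0 has a nonnegative form value, whereas lifts of points of
  \<open>D2\<close> have negative values, which \<open>A\<close> preserves.\<close>

lemma denom_nonzero:
  assumes "A \<in> picard_group" "z \<in> D2"
  shows "denom A z \<noteq> 0"
proof
  assume 0: "denom A z = 0"
  have "herm (A *v hom_coord z) (C_form *v (A *v hom_coord z)) = of_real (- 2 * height z)"
    using picard_herm_C_form[OF assms(1)] herm_hom_coord[of 1 z] by simp
  moreover have "(A *v hom_coord z)$1 = 0"
    using 0 by simp
  ultimately have "(cmod ((A *v hom_coord z)$2))\<^sup>2 = - 2 * height z"
    unfolding herm_C_form of_real_eq_iff by simp
  moreover have "0 < height z" using assms(2) by (simp add: D2_iff_height)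
  ultimately show False using zero_le_power2[of "cmod ((A *v hom_coord z)$2)"] by linarith
qed

lemma height_act:
  assumes "A \<in> picard_group" "z \<in> D2"
  shows "(cmod (denom A z))\<^sup>2 * height (act A z) = height z"
proof -
  have "herm (A *v hom_coord z) (C_form *v (A *v hom_coord z)) = of_real (- 2 * height z)"
    using picard_herm_C_form[OF assms(1)] herm_hom_coord[of 1 z] by simp
  then show ?thesis
    unfolding act_hom_coord[OF denom_nonzero[OF assms]] herm_hom_coord of_real_eq_iff by simp
qed

lemma act_D2:
  assumes "A \<in> picard_group" "z \<in> D2"
  shows "act A z \<in> D2"
  using height_act[OF assms] assms(2) denom_nonzero[OF assms]
  by (metis D2_iff_height zero_less_mult_pos zero_less_norm_iff zero_less_power)

lemma picard_act_mult:
  assumes "A \<in> picard_group" "B \<in> picard_group" "z \<in> D2"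
  shows "denom (A ** B) z = denom B z * denom A (act B z)"
    and "act (A ** B) z = act A (act B z)"
  using act_mult denom_nonzero act_D2 assms by blast+

lemma picard_act_inverse:
  assumes "A \<in> picard_group" "z \<in> D2"
  shows "act (picard_inverse A) (act A z) = z" "act A (act (picard_inverse A) z) = z"
  using assms picard_act_mult(2)[OF picard_group_inverse[OF assms(1)] assms]
    picard_act_mult(2)[OF assms(1) picard_group_inverse[OF assms(1)] assms(2)]
    picard_inverse_left picard_inverse_right by auto

section \<open>Automorphisms and their Jacobians\<close>

lemma has_derivative_act:
  assumes nz: "denom A z \<noteq> 0"
  shows "\<exists>L :: complex^2^2. (act A has_derivative (\<lambda>h. L *v h)) (at z)
           \<and> det L = det A / denom A z ^ 3"
proof -
  define e :: "2 \<Rightarrow> complex \<Rightarrow> complex^2" where "e i = axis i" for i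
  have e: "bounded_linear (e i)" for i
    unfolding linear_conv_bounded_linear[symmetric]
    by (rule linearI) (auto simp: e_def axis_def vec_eq_iff)
  define num where "num j w = A$j$1 + A$j$2 * w$1 + A$j$3 * w$2" for j and w :: "complex^2"
  have num: "(num j has_derivative (\<lambda>h. A$j$2 * h$1 + A$j$3 * h$2)) (at z)" for j
    unfolding num_def
    by (auto intro!: derivative_eq_intros bounded_linear.has_derivative[OF bounded_linear_vec_nth])
  have n1: "num 1 z \<noteq> 0" using nz by (simp add: num_def denom_def)
  define D where "D j h = ((A$j$2 * h$1 + A$j$3 * h$2) * num 1 z
      - num j z * (A$1$2 * h$1 + A$1$3 * h$2)) / (num 1 z * num 1 z)" for j and h :: "complex^2"
  have q: "((\<lambda>w. num j w / num 1 w) has_derivative D j) (at z)" for j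
    unfolding D_def by (rule has_derivative_divide'[OF num num n1])
  have act: "act A = (\<lambda>w. e 1 (num 2 w / num 1 w) + e 2 (num 3 w / num 1 w))"
    by (auto simp: act_def e_def axis_def vec_eq_iff forall_2 num_def)
  have d: "(act A has_derivative (\<lambda>h. e 1 (D 2 h) + e 2 (D 3 h))) (at z)"
    unfolding act by (intro has_derivative_add bounded_linear.has_derivative[OF e] q)
  define c where "c j k = (A$j$k * num 1 z - num j z * A$1$k) / (num 1 z * num 1 z)" for j k
  define L :: "complex^2^2" where "L = vector [vector [c 2 2, c 2 3], vector [c 3 2, c 3 3]]"
  have "(\<lambda>h. e 1 (D 2 h) + e 2 (D 3 h)) = (\<lambda>h. L *v h)"
    by (auto simp: L_def e_def axis_def vec_eq_iff forall_2 matrix_vector_mult_def sum_2 c_def D_def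
        add_divide_distrib diff_divide_distrib algebra_simps)
  moreover have "det L = det A / denom A z ^ 3"
  proof -
    \<comment> \<open>Each \<open>c j k\<close> has the denominator \<open>num 1 z\<close> squared,
      hence the fourth power; the numerator contains one factor \<open>num 1 z\<close>, which leaves
      the cube.\<close>
    have "det L * num 1 z ^ 4 = ((A$2$2 * num 1 z - num 2 z * A$1$2) * (A$3$3 * num 1 z - num 3 z * A$1$3)
       - (A$2$3 * num 1 z - num 2 z * A$1$3) * (A$3$2 * num 1 z - num 3 z * A$1$2))"
      using n1 by (simp add: L_def det_2 c_def power4_eq_xxxx field_simps)
    also have "\<dots> = det A * num 1 z"
      unfolding det_3 num_def by algebra
    finally have "(det L * num 1 z ^ 3) * num 1 z = det A * num 1 z"
      by (simp add: mult.assoc power_Suc2[symmetric] del: power_Suc)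
    then have "det L * num 1 z ^ 3 = det A" using n1 by simp
    moreover have "num 1 z = denom A z" by (simp add: num_def denom_def)
    ultimately show ?thesis using nz by (simp add: eq_divide_eq)
  qed
  ultimately show ?thesis using d by auto
qed

lemma holo_on_cong:
  assumes "holo_on f S" "\<And>z. z \<in> S \<Longrightarrow> g z = f z"
  shows "holo_on g S"
  unfolding holo_on_def
proof
  fix z assume z: "z \<in> S"
  with assms obtain L :: "complex^2^2" where "(f has_derivative (\<lambda>h. L *v h)) (at z within S)"
    unfolding holo_on_def by blast
  then have "(g has_derivative (\<lambda>h. L *v h)) (at z within S)"
    by (rule has_derivative_transform[OF z assms(2), rotated]) auto
  then show "\<exists>L :: complex^2^2. (g has_derivative (\<lambda>h. L *v h)) (at z within S)" by blast
qed

lemma holo_on_act: "A \<in> picard_group \<Longrightarrow> holo_on (act A) D2"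
  unfolding holo_on_def
  using has_derivative_act denom_nonzero has_derivative_at_withinI by metis

lemma in_picard_if_given_by:
  assumes A: "A \<in> picard_group" and f: "given_by f A"
  shows "in_picard f"
proof -
  have fA: "f z = act A z" if "z \<in> D2" for z using f that by (simp add: given_by_def)
  have bij: "bij_betw f D2 D2"
    by (rule bij_betw_byWitness[where f' = "act (picard_inverse A)"])
       (auto simp: fA picard_act_inverse A act_D2 picard_group_inverse)
  have "inv_into D2 f z = act (picard_inverse A) z" if "z \<in> D2" for z
    by (rule inv_into_f_eq[OF bij_betw_imp_inj_on[OF bij]])
       (use that A in \<open>auto simp: fA act_D2 picard_group_inverse picard_act_inverse\<close>)
  then have "holo_on (inv_into D2 f) D2"
    using holo_on_cong holo_on_act picard_group_inverse[OF A] by metis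
  moreover have "holo_on f D2" using holo_on_cong holo_on_act[OF A] fA by metis
  ultimately show ?thesis
    using bij A f by (auto simp: in_picard_def D2_automorphism_def)
qed

lemma open_D2: "open D2"
  unfolding D2_def by (intro open_Collect_less continuous_intros) auto

text \<open>\<open>f\<close> and \<open>act A\<close> need to agree only on \<open>D2\<close>; since
  \<open>D2\<close> is open, the derivative carries over.\<close>

lemma complex_jacobian_det_given_by:
  assumes A: "A \<in> picard_group" and f: "given_by f A" and z: "z \<in> D2"
  shows "complex_jacobian_det f z = 1 / denom A z ^ 3"
proof -
  obtain L :: "complex^2^2" where L: "(act A has_derivative (\<lambda>h. L *v h)) (at z)"
    "det L = det A / denom A z ^ 3"
    using has_derivative_act[OF denom_nonzero[OF A z]] by blast
  have "(f has_derivative (\<lambda>h. L *v h)) (at z)"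
    by (rule has_derivative_transform_within_open[OF L(1) open_D2 z])
       (use f in \<open>simp add: given_by_def\<close>)
  then have "frechet_derivative f (at z) = (\<lambda>h. L *v h)"
    using frechet_derivative_at by metis
  then show ?thesis
    using L(2) A by (simp add: complex_jacobian_det_def jacobian_def picard_group_def)
qed

section \<open>Isometric spheres over the prism\<close>

text \<open>If the bound failed, the unit sphere would force \<open>p\<close> close to \<open>1\<close>. With \<open>s = 1 - p\<close>, the other two
  spheres then give \<open>x = O(s)\<close>, whereas the unit sphere needs \<open>x\<^sup>2 \<ge> 2 s - O(s\<^sup>2)\<close>.\<close>

lemma height_ge_half_if_le:
  fixes p q x y :: real
  assumes q: "0 \<le> q" "q \<le> p" "p + q \<le> 1" and x: "\<bar>x\<bar> \<le> 1/2" and y: "0 < y"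
    and J: "x\<^sup>2 + y\<^sup>2 \<ge> 1"
    and G5: "(x + q - 1/2)\<^sup>2 + (y - p + 1/2)\<^sup>2 \<ge> 1/2"
    and G6: "(x + q + 1/2)\<^sup>2 + (y - p + 1/2)\<^sup>2 \<ge> 1/2"
  shows "y \<ge> 1/2 + (p\<^sup>2 + q\<^sup>2) / 2"
proof (rule ccontr)
  assume "\<not> ?thesis"
  then have lt: "y < 1/2 + (p\<^sup>2 + q\<^sup>2) / 2" by simp
  define s t where "s = 1 - p" and "t = x + q"
  have s: "q \<le> s" "0 \<le> s" using q by (auto simp: s_def)
  have q2: "q\<^sup>2 \<le> s\<^sup>2" using q(1) s by (simp add: power_mono)
  have "x\<^sup>2 \<le> (1/2)\<^sup>2" using x by (simp add: abs_le_square_iff[symmetric])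
  then have y2: "y\<^sup>2 \<ge> 3/4" using J by (simp add: power_divide)
  have "43/50 < y" using y y2 by (intro power2_less_imp_less[of _ y]) (auto simp: power2_eq_square)
  then have pq: "p\<^sup>2 + (1 - p)\<^sup>2 > 18/25" using lt q2 by (simp add: s_def field_simps)
  have "q\<^sup>2 \<le> p\<^sup>2" using q by (intro power_mono)
  then have "p\<^sup>2 > (3/5)\<^sup>2"
    using lt \<open>43/50 < y\<close> by (simp add: power_divide field_simps)
  then have p: "3/5 < p" using q by (intro power2_less_imp_less[of _ p]) auto
  have s17: "s < 17/100"
  proof (rule ccontr)
    assume "\<not> ?thesis"
    then have "(p - 83/100) * (p - 17/100) \<le> 0"
      using p by (intro mult_nonpos_nonneg) (auto simp: s_def)
    then show False using pq by (simp add: power2_eq_square field_simps)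
  qed
  have s2: "s\<^sup>2 \<le> 17/100 * s" using s s17 mult_right_mono[of s "17/100" s] by (simp add: power2_eq_square)
  have s4: "s^4 \<le> 3/100 * s\<^sup>2"
  proof -
    have "s\<^sup>2 * s\<^sup>2 \<le> 3/100 * s\<^sup>2" using s2 s17 by (intro mult_right_mono) auto
    then show ?thesis by (simp add: power2_eq_square power4_eq_xxxx)
  qed
  define Y where "Y = y - p + 1/2"
  have "(p\<^sup>2 + q\<^sup>2) / 2 \<le> 1/2 - s + s\<^sup>2"
    using q2 by (simp add: s_def power2_eq_square field_simps)
  then have ylt: "y < 1 - s + s\<^sup>2" using lt by (simp add: field_simps)
  then have "Y < 1/2 + s\<^sup>2" by (simp add: Y_def s_def)
  moreover have "0 < Y" using \<open>43/50 < y\<close> q by (simp add: Y_def)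
  ultimately have "Y\<^sup>2 \<le> (1/2 + s\<^sup>2)\<^sup>2" by (intro power_mono) auto
  then have Y2: "Y\<^sup>2 \<le> 1/4 + s\<^sup>2 + s^4" by (simp add: power2_eq_square power4_eq_xxxx field_simps)
  have t67: "\<bar>t\<bar> \<le> 67/100" using x q s s17 unfolding t_def by linarith
  \<comment> \<open>\<open>G5\<close> serves for \<open>t \<ge> 0\<close> and \<open>G6\<close> for
    \<open>t < 0\<close>: in both cases
    \<open>(\<bar>t\<bar> - 1/2)\<^sup>2 + Y\<^sup>2 \<ge> 1/2\<close>.\<close>
  have "\<bar>t\<bar> - t\<^sup>2 \<le> s\<^sup>2 + s^4"
    using G5 G6 Y2 unfolding Y_def[symmetric] t_def[symmetric]
    by (auto simp: power2_eq_square abs_if field_simps)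
  moreover have "t\<^sup>2 \<le> 67/100 * \<bar>t\<bar>"
    using t67 mult_right_mono[of "\<bar>t\<bar>" "67/100" "\<bar>t\<bar>"] by (simp add: power2_eq_square)
  ultimately have "33/100 * \<bar>t\<bar> \<le> 103/100 * s\<^sup>2" using s4 by simp
  then have "\<bar>t\<bar> \<le> 55/100 * s" using s2 s by simp
  then have "\<bar>x\<bar> \<le> 155/100 * s" using s q(1) unfolding t_def by linarith
  then have "x\<^sup>2 \<le> (155/100 * s)\<^sup>2" using s by (simp add: abs_le_square_iff[symmetric])
  also have "(155/100 * s)\<^sup>2 \<le> 241/100 * s\<^sup>2"
    unfolding power_mult_distrib by (intro mult_right_mono) (auto simp: power_divide)
  finally have x2: "x\<^sup>2 \<le> 241/100 * s\<^sup>2" .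
  have "y\<^sup>2 < (1 - s + s\<^sup>2)\<^sup>2" using ylt y by (intro power_strict_mono) auto
  also have "\<dots> \<le> 1 - 2 * s + 3 * s\<^sup>2"
  proof -
    have "(1 - s + s\<^sup>2)\<^sup>2 = 1 - 2 * s + 3 * s\<^sup>2 - s^3 * (2 - s)" by algebra
    moreover have "0 \<le> s^3 * (2 - s)" using s s17 by (intro mult_nonneg_nonneg) auto
    ultimately show ?thesis by simp
  qed
  \<comment> \<open>The bounds add up to
    \<open>x\<^sup>2 + y\<^sup>2 < 1 - 2 * s + 541/100 * s\<^sup>2\<close>, which is at most 1
    because \<open>s < 17/100\<close>.\<close>
  finally show False using x2 J s2 s by simp
qed

text \<open>The region in the real coordinates \<open>z\<^sub>1 = p + q \<i>\<close> and
  \<open>z\<^sub>2 = x + y \<i>\<close>: the prism, membership in \<open>D2\<close>, and the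
  exteriors of the eight isometric spheres.\<close>

locale ford_ineqs =
  fixes p q x y :: real
  assumes triangle: "0 \<le> p" "0 \<le> q" "p + q \<le> 1" and strip: "\<bar>x\<bar> \<le> 1/2"
    and above: "y > (p\<^sup>2 + q\<^sup>2) / 2"
    and unit_sphere: "x\<^sup>2 + y\<^sup>2 \<ge> 1"
    and first_spheres: "r \<in> {-1, 0, 1} \<Longrightarrow> (x + r - p + q)\<^sup>2 + (y + 1 - p - q)\<^sup>2 \<ge> 1"
    and second_spheres: "r \<in> {-1, 1} \<Longrightarrow> (x + q + r/2)\<^sup>2 + (y - p + 1/2)\<^sup>2 \<ge> 1/2"
    and third_spheres: "r \<in> {-1, 1} \<Longrightarrow> (x - p + r/2)\<^sup>2 + (y - q + 1/2)\<^sup>2 \<ge> 1/2"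
begin

definition h :: real where "h = y - (p\<^sup>2 + q\<^sup>2) / 2"

lemma y_pos: "0 < y"
  by (rule order_le_less_trans[OF _ above]) simp

text \<open>The reflection that swaps \<open>p\<close> and \<open>q\<close> and negates
  \<open>x\<close> exchanges the second and third spheres, so \<open>height_ge_half_if_le\<close>
  covers both halves of the triangle.\<close>

lemma h_ge_half: "1/2 \<le> h"
proof (cases "q \<le> p")
  case True
  then show ?thesis
    using height_ge_half_if_le[of q p x y] triangle strip y_pos unit_sphere
      second_spheres[of 1] second_spheres[of "-1"]
    by (simp add: h_def field_simps)
next
  case False
  have "(- x + p - 1/2)\<^sup>2 = (x - p + 1/2)\<^sup>2" "(- x + p + 1/2)\<^sup>2 = (x - p - 1/2)\<^sup>2"
    by (simp_all add: power2_eq_square algebra_simps)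
  then show ?thesis
    using height_ge_half_if_le[of p q "- x" y] False triangle strip y_pos unit_sphere
      third_spheres[of 1] third_spheres[of "-1"]
    by (simp add: h_def field_simps)
qed

lemma int_translate_sphere: "(x + of_int k)\<^sup>2 + y\<^sup>2 \<ge> 1"
proof -
  have "\<bar>x\<bar> \<le> \<bar>x + of_int k\<bar>"
  proof (cases "k = 0")
    case False
    then have "1 \<le> \<bar>real_of_int k\<bar>" by linarith
    then show ?thesis using strip by linarith
  qed simp
  then show ?thesis using unit_sphere by (simp add: abs_le_square_iff)
qed

text \<open>The two squares are those of the real and imaginary parts of \<open>z\<^sub>2 + \<beta> z\<^sub>1 + \<alpha>\<close> for
  \<open>\<beta> = m + n \<i>\<close> and \<open>\<alpha> = r + \<i> \<bar>\<beta>\<bar>\<^sup>2 / 2\<close>; in \<open>norm_2_sphere\<close>, \<open>\<alpha> = (r + \<i> \<bar>\<beta>\<bar>\<^sup>2) / 2\<close>.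
  When \<open>\<bar>a\<^sub>1\<^sub>3\<bar>\<^sup>2\<close> is 1 or 2, denominators have this form up to a factor of modulus \<open>\<bar>a\<^sub>1\<^sub>3\<bar>\<close>.\<close>

lemma norm_1_sphere:
  fixes m n r :: int
  assumes "even (m + n)"
  shows "(x + m * p - n * q + r)\<^sup>2 + (h + ((m + q)\<^sup>2 + (n + p)\<^sup>2) / 2)\<^sup>2 \<ge> 1"
    (is "?X\<^sup>2 + ?Y\<^sup>2 \<ge> 1")
\<comment> \<open>The sum is the squared distance of \<open>z\<^sub>1\<close> from the point over
  which the sphere is centred. When it is large, \<open>?Y\<close> alone suffices.\<close>
proof (cases "(m + q)\<^sup>2 + (n + p)\<^sup>2 \<ge> 1")
  case True
  then have "1 \<le> ?Y" using h_ge_half by (simp add: field_simps)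
  then have "1 \<le> ?Y\<^sup>2" by simp
  then show ?thesis by (simp add: add_increasing)
next
  case False
  moreover have "0 \<le> (m + q)\<^sup>2" "0 \<le> (n + p)\<^sup>2" by simp_all
  ultimately have "(m + q)\<^sup>2 < 1" "(n + p)\<^sup>2 < 1" by linarith+
  then have "\<bar>m + q\<bar> < 1" "\<bar>n + p\<bar> < 1" by (simp_all add: abs_square_less_1)
  then have "m \<in> {-1, 0}" "n \<in> {-1, 0}" using triangle by auto
  \<comment> \<open>Parity leaves two centres: over 0, where the spheres are integer translates of
    the unit sphere, and over \<open>1 + \<i>\<close>, where they belong to
    \<open>first_spheres\<close>.\<close>
  then consider "m = 0" "n = 0" | "m = -1" "n = -1" using assms by auto
  then show ?thesis
  proof cases
    case 1
    then show ?thesis using int_translate_sphere[of r] by (simp add: h_def add.commute)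
  next
    case 2
    have Y: "?Y = y + 1 - p - q" using 2 by (simp add: h_def power2_eq_square field_simps)
    \<comment> \<open>As \<open>x - p + q\<close> has modulus at most \<open>3/2\<close>, clamping
      \<open>r\<close> to \<open>-1, 0, 1\<close> never increases the modulus of the sum.\<close>
    define k :: int where "k = max (-1) (min 1 r)"
    have k: "k \<in> {-1, 0, 1}" by (auto simp: k_def)
    have "\<bar>x + k - p + q\<bar> \<le> \<bar>x + r - p + q\<bar>"
    proof -
      have "r \<le> -2 \<or> r = k \<or> 2 \<le> r" by (auto simp: k_def)
      moreover have "r \<le> -2 \<Longrightarrow> real_of_int r \<le> -2" "r \<ge> 2 \<Longrightarrow> real_of_int r \<ge> 2" by linarith+
      moreover have "r \<le> -2 \<Longrightarrow> k = -1" "r \<ge> 2 \<Longrightarrow> k = 1" by (auto simp: k_def)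
      ultimately show ?thesis using triangle strip by auto
    qed
    then have "(x + k - p + q)\<^sup>2 \<le> (x + r - p + q)\<^sup>2" by (simp add: abs_le_square_iff)
    moreover have "(x + k - p + q)\<^sup>2 + (y + 1 - p - q)\<^sup>2 \<ge> 1" using first_spheres[of k] k by auto
    moreover have X: "?X = x + r - p + q" using 2 by simp
    ultimately show ?thesis unfolding X Y by linarith
  qed
qed

lemma norm_2_sphere:
  fixes m n r :: int
  assumes "even (m + n + r)"
  shows "(x + m * p - n * q + r/2)\<^sup>2 + (h + ((m + q)\<^sup>2 + (n + p)\<^sup>2) / 2)\<^sup>2 \<ge> 1/2"
    (is "?X\<^sup>2 + ?Y\<^sup>2 \<ge> 1/2")
proof (cases "(m + q)\<^sup>2 + (n + p)\<^sup>2 \<ge> 1/2")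
  case True
  then have "3/4 \<le> ?Y" using h_ge_half by (simp add: field_simps)
  then have "(3/4)\<^sup>2 \<le> ?Y\<^sup>2" by (intro power_mono) auto
  then have "1/2 \<le> ?Y\<^sup>2" by (simp add: power_divide)
  then show ?thesis by (simp add: add_increasing)
next
  case False
  then have lt: "(m + q)\<^sup>2 + (n + p)\<^sup>2 < 1/2" by simp
  moreover have "0 \<le> (m + q)\<^sup>2" "0 \<le> (n + p)\<^sup>2" by simp_all
  ultimately have "(m + q)\<^sup>2 < 1" "(n + p)\<^sup>2 < 1" by linarith+
  then have "\<bar>m + q\<bar> < 1" "\<bar>n + p\<bar> < 1" by (simp_all add: abs_square_less_1)
  then have mn: "m \<in> {-1, 0}" "n \<in> {-1, 0}" using triangle by auto
  \<comment> \<open>The triangle has distance at least \<open>1 / sqrt 2\<close> from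
    \<open>1 + \<i>\<close>, so spheres centred there fall under the first case.\<close>
  have far: "\<not> (1 - q)\<^sup>2 + (1 - p)\<^sup>2 < 1/2"
  proof
    assume "(1 - q)\<^sup>2 + (1 - p)\<^sup>2 < 1/2"
    moreover have "0 \<le> (p - q)\<^sup>2" by simp
    moreover have "1\<^sup>2 \<le> (2 - p - q)\<^sup>2" using triangle by (intro power_mono) auto
    ultimately show False by (simp add: power2_eq_square algebra_simps)
  qed
  have Y_half: "1/4 \<le> ?Y\<^sup>2"
  proof -
    have "0 \<le> ((m + q)\<^sup>2 + (n + p)\<^sup>2) / 2" by simp
    then have "1/2 \<le> ?Y" using h_ge_half by linarith
    then have "(1/2)\<^sup>2 \<le> ?Y\<^sup>2" by (intro power_mono) auto
    then show ?thesis by (simp add: power_divide)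
  qed
  have X_half: ?thesis if "1/2 \<le> \<bar>?X\<bar>"
  proof -
    have "(1/2)\<^sup>2 \<le> \<bar>?X\<bar>\<^sup>2" using that by (intro power_mono) auto
    then have "1/4 \<le> ?X\<^sup>2" by (simp add: power_divide)
    then show ?thesis using Y_half by linarith
  qed
  consider "m = 0" "n = 0" | "m = 0" "n = -1" | "m = -1" "n = 0"
    using mn far lt by (auto simp: power2_commute)
  then show ?thesis
  proof cases
    case 1
    then obtain k where "r = 2 * k" using assms by auto
    then show ?thesis using 1 int_translate_sphere[of k] by (simp add: h_def add.commute)
  next
    case 2
    \<comment> \<open>This keeps \<open>x + q\<close> below 1, which makes
      \<open>?X \<le> -1/2\<close> for \<open>r \<le> -3\<close>. In the mirrored case below,
      \<open>p < 1/2\<close> does the same for \<open>r \<ge> 3\<close>.\<close>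
    have q: "q < 1/2"
    proof (rule ccontr)
      assume "\<not> q < 1/2"
      then have "(1/2)\<^sup>2 \<le> q\<^sup>2" "(1/2)\<^sup>2 \<le> (1 - p)\<^sup>2" using triangle by (intro power_mono; simp)+
      then show False using lt 2 by (simp add: power2_eq_square algebra_simps)
    qed
    have "odd r" using assms 2 by simp
    then have "r \<noteq> 0" "r \<noteq> 2" "r \<noteq> -2" by auto
    then consider "r \<in> {-1, 1}" | "r \<ge> 3" | "r \<le> -3" by force
    then show ?thesis
    proof cases
      case 1
      have "?Y = y - p + 1/2" using 2 by (simp add: h_def power2_eq_square field_simps)
      then show ?thesis using second_spheres[of r] 1 2 by auto
    next
      case r: 2
      then have "real_of_int r \<ge> 3" by linarith
      then show ?thesis using 2 triangle strip by (intro X_half) auto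
    next
      case r: 3
      then have "real_of_int r \<le> -3" by linarith
      then show ?thesis using 2 triangle strip q by (intro X_half) auto
    qed
  next
    case 3
    have p: "p < 1/2"
    proof (rule ccontr)
      assume "\<not> p < 1/2"
      then have "(1/2)\<^sup>2 \<le> p\<^sup>2" "(1/2)\<^sup>2 \<le> (1 - q)\<^sup>2" using triangle by (intro power_mono; simp)+
      then show False using lt 3 by (simp add: power2_eq_square algebra_simps)
    qed
    have "odd r" using assms 3 by simp
    then have "r \<noteq> 0" "r \<noteq> 2" "r \<noteq> -2" by auto
    then consider "r \<in> {-1, 1}" | "r \<ge> 3" | "r \<le> -3" by force
    then show ?thesis
    proof cases
      case 1
      have "?Y = y - q + 1/2" using 3 by (simp add: h_def power2_eq_square field_simps)
      then show ?thesis using third_spheres[of r] 1 3 by auto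
    next
      case r: 2
      then have "real_of_int r \<ge> 3" by linarith
      then show ?thesis using 3 triangle strip p by (intro X_half) auto
    next
      case r: 3
      then have "real_of_int r \<le> -3" by linarith
      then show ?thesis using 3 triangle strip by (intro X_half) auto
    qed
  qed
qed

end

section \<open>Denominators\<close>

text \<open>Multiplication by \<open>cnj c\<close> makes the coefficient of \<open>z\<^sub>2\<close>
  real, and the null condition completes the square. Both summands are nonnegative on
  \<open>D2\<close>, so a bound for the denominator bounds \<open>c\<close> and then
  \<open>b\<close>.\<close>

lemma Im_denom_times_cnj:
  assumes "(cmod b)\<^sup>2 = 2 * Im (a * cnj c)"
  shows "Im ((a + b * z$1 + c * z$2) * cnj c)
       = (cmod c)\<^sup>2 * height z + (cmod (b + \<i> * c * cnj (z$1)))\<^sup>2 / 2"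
proof -
  have "2 * Im (a * cnj c) = (Re b)\<^sup>2 + (Im b)\<^sup>2" using assms by (simp add: cmod_power2)
  then have "Im a * Re c - Re a * Im c = ((Re b)\<^sup>2 + (Im b)\<^sup>2) / 2" by simp
  moreover have "Im ((a + b * z$1 + c * z$2) * cnj c)
     = (Im a * Re c - Re a * Im c) + Im ((b * z$1 + c * z$2) * cnj c)"
    by (simp add: algebra_simps)
  ultimately show ?thesis
    by (simp add: height_def cmod_power2) (simp add: field_simps power2_eq_square)
qed

lemma picard_Im_denom:
  "A \<in> picard_group \<Longrightarrow> Im (denom A z * cnj (A$1$3))
     = (cmod (A$1$3))\<^sup>2 * height z + (cmod (A$1$2 + \<i> * A$1$3 * cnj (z$1)))\<^sup>2 / 2"
  using Im_denom_times_cnj[OF picard_group_row_null] by (simp add: denom_def)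

lemma height_le_denom:
  assumes "A \<in> picard_group"
  shows "cmod (A$1$3) * height z \<le> cmod (denom A z)"
proof (cases "A$1$3 = 0")
  case False
  have "cmod (A$1$3) * (cmod (A$1$3) * height z) \<le> Im (denom A z * cnj (A$1$3))"
    using picard_Im_denom[OF assms, of z] by (simp add: power2_eq_square)
  also have "\<dots> \<le> cmod (A$1$3) * cmod (denom A z)"
    using abs_Im_le_cmod[of "denom A z * cnj (A$1$3)"] by (simp add: norm_mult mult.commute)
  finally show ?thesis using False by simp
qed simp

lemma one_le_cmod_square_iff: "1 \<le> (cmod x)\<^sup>2 \<longleftrightarrow> 1 \<le> cmod x"
  using abs_le_square_iff[of 1 "cmod x"] by simp

lemma norm_gaussian_integer_ge_1:
  assumes "x \<in> gaussian_integers" "x \<noteq> 0"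
  shows "1 \<le> cmod x"
proof -
  obtain m n :: int where x: "x = Complex m n" using assms(1) by (rule gaussian_integersE)
  then have "1 \<le> m\<^sup>2 + n\<^sup>2"
    using assms(2) sum_power2_gt_zero_iff[of m n] by (auto simp: complex_eq_iff)
  then have "1 \<le> (cmod x)\<^sup>2" unfolding x cmod_power2 complex.sel by (metis of_int_1_le_iff of_int_add of_int_power)
  then show ?thesis by (simp only: one_le_cmod_square_iff)
qed

lemma finite_gaussian_integers_bounded: "finite {x \<in> gaussian_integers. cmod x \<le> R}"
proof (rule finite_subset)
  show "{x \<in> gaussian_integers. cmod x \<le> R}
      \<subseteq> (\<lambda>(m, n). Complex (of_int m) (of_int n)) ` ({- \<lceil>R\<rceil>..\<lceil>R\<rceil>} \<times> {- \<lceil>R\<rceil>..\<lceil>R\<rceil>})"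
  proof
    fix x assume x: "x \<in> {x \<in> gaussian_integers. cmod x \<le> R}"
    then obtain m n :: int where mn: "x = Complex m n" by (auto elim: gaussian_integersE)
    have "\<bar>real_of_int m\<bar> \<le> R" "\<bar>real_of_int n\<bar> \<le> R"
      using x mn abs_Re_le_cmod[of x] abs_Im_le_cmod[of x] by auto
    then have "m \<in> {- \<lceil>R\<rceil>..\<lceil>R\<rceil>}" "n \<in> {- \<lceil>R\<rceil>..\<lceil>R\<rceil>}" by (auto, linarith+)
    then show "x \<in> (\<lambda>(m, n). Complex (of_int m) (of_int n)) ` ({- \<lceil>R\<rceil>..\<lceil>R\<rceil>} \<times> {- \<lceil>R\<rceil>..\<lceil>R\<rceil>})"
      using mn by auto
  qed
qed auto

text \<open>Small denominators bound \<open>a\<^sub>1\<^sub>3\<close>, then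
  \<open>a\<^sub>1\<^sub>2\<close>, then \<open>a\<^sub>1\<^sub>1\<close>, and bounded Gaussian
  integers are finite in number. Values are counted instead of matrices because infinitely many
  matrices can share a first row.\<close>

lemma finite_small_denoms:
  assumes z: "z \<in> D2"
  shows "finite {denom A z | A. A \<in> picard_group \<and> cmod (denom A z) \<le> 1}"
proof -
  define c0 where "c0 = 1 / height z"
  define b0 where "b0 = 2 * c0 + 1 + c0 * cmod (z$1)"
  define a0 where "a0 = 1 + b0 * cmod (z$1) + c0 * cmod (z$2)"
  define B where "B R = {x \<in> gaussian_integers. cmod x \<le> R}" for R
  have h: "height z > 0" using z by (simp add: D2_iff_height)
  define K where "K = (\<lambda>(a, b, c). a + b * z$1 + c * z$2) ` (B a0 \<times> B b0 \<times> B c0)"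
  have "denom A z \<in> K"
    if A: "A \<in> picard_group" and d: "cmod (denom A z) \<le> 1" for A
  proof -
    have c: "cmod (A$1$3) \<le> c0"
      using height_le_denom[OF A, of z] d h by (simp add: c0_def field_simps)
    have "(cmod (A$1$2 + \<i> * A$1$3 * cnj (z$1)))\<^sup>2 / 2 \<le> Im (denom A z * cnj (A$1$3))"
      using picard_Im_denom[OF A, of z] h by simp
    also have "\<dots> \<le> cmod (denom A z) * cmod (A$1$3)"
      using abs_Im_le_cmod[of "denom A z * cnj (A$1$3)"] by (simp add: norm_mult)
    also have "\<dots> \<le> 1 * c0" using c d by (intro mult_mono) auto
    finally have sq: "(cmod (A$1$2 + \<i> * A$1$3 * cnj (z$1)))\<^sup>2 \<le> 2 * c0" by simp
    \<comment> \<open>This turns the bound for the square into a bound for the modulus without a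
      square root.\<close>
    have le_square: "t \<le> t\<^sup>2 + 1" if "0 \<le> t" for t :: real
      using zero_le_power2[of "t - 1"] that unfolding power2_diff by simp
    have "cmod (A$1$2 + \<i> * A$1$3 * cnj (z$1)) \<le> 2 * c0 + 1"
      using sq le_square[OF norm_ge_zero, of "A$1$2 + \<i> * A$1$3 * cnj (z$1)"] by linarith
    moreover have "cmod (A$1$2) \<le> cmod (A$1$2 + \<i> * A$1$3 * cnj (z$1)) + cmod (\<i> * A$1$3 * cnj (z$1))"
      by (rule norm_triangle_sub[of "A$1$2" "A$1$2 + \<i> * A$1$3 * cnj (z$1)", simplified, THEN order_trans])
         (simp add: norm_minus_commute)
    moreover have "cmod (\<i> * A$1$3 * cnj (z$1)) \<le> c0 * cmod (z$1)"
      using c by (simp add: norm_mult mult_right_mono)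
    ultimately have b: "cmod (A$1$2) \<le> b0" by (simp add: b0_def)
    have "A$1$1 = denom A z - (A$1$2 * z$1 + A$1$3 * z$2)" by (simp add: denom_def)
    also have "cmod \<dots> \<le> cmod (denom A z) + (cmod (A$1$2 * z$1) + cmod (A$1$3 * z$2))"
      by (meson norm_triangle_ineq norm_triangle_ineq4 add_left_mono order_trans)
    also have "\<dots> \<le> a0"
      using b c d unfolding a0_def norm_mult add.assoc by (intro add_mono mult_right_mono) auto
    finally have "cmod (A$1$1) \<le> a0" .
    then show ?thesis
      unfolding K_def using A b c by (intro image_eqI[of _ _ "(A$1$1, A$1$2, A$1$3)"])
        (auto simp: denom_def B_def picard_group_def)
  qed
  then have "{denom A z | A. A \<in> picard_group \<and> cmod (denom A z) \<le> 1} \<subseteq> K" by blast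
  moreover have "finite K" using finite_gaussian_integers_bounded by (simp add: K_def B_def)
  ultimately show ?thesis by (rule finite_subset)
qed

lemma denom_mat_1 [simp]: "denom (mat 1) z = 1"
  by (simp add: denom_def mat_def)

text \<open>By \<open>height_act\<close>, maximal height means minimal modulus of the denominator.
  The identity has denominator 1, so the minimum can be sought in the finite set of denominators of
  modulus at most 1.\<close>

lemma ex_max_height:
  assumes z: "z \<in> D2"
  obtains A where "A \<in> picard_group" "\<And>B. B \<in> picard_group \<Longrightarrow> height (act B z) \<le> height (act A z)"
proof -
  let ?D = "{denom A z | A. A \<in> picard_group \<and> cmod (denom A z) \<le> 1}"
  have "1 \<in> ?D" using picard_group_1 denom_mat_1[of z] by (auto intro!: exI[of _ "mat 1"])
  then have ne: "?D \<noteq> {}" by blast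
  obtain A where A: "A \<in> picard_group" "cmod (denom A z) \<le> 1" "arg_min_on cmod ?D = denom A z"
    using arg_min_if_finite(1)[OF finite_small_denoms[OF z] ne] by auto
  have min: "cmod (denom A z) \<le> cmod (denom B z)"
    if "B \<in> picard_group" "cmod (denom B z) \<le> 1" for B
    using arg_min_least[OF finite_small_denoms[OF z] ne, of "denom B z" cmod] that A(3) by auto
  show thesis
  proof
    fix B assume B: "B \<in> picard_group"
    have "cmod (denom A z) \<le> cmod (denom B z)" using A(2) min[OF B] by linarith
    then have le: "(cmod (denom A z))\<^sup>2 \<le> (cmod (denom B z))\<^sup>2" by (intro power_mono) auto
    have "0 < height (act B z)" using act_D2[OF B z] by (simp add: D2_iff_height)
    then have "(cmod (denom A z))\<^sup>2 * height (act B z) \<le> (cmod (denom B z))\<^sup>2 * height (act B z)"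
      using le by (simp add: mult_right_mono)
    then have "(cmod (denom A z))\<^sup>2 * height (act B z) \<le> (cmod (denom A z))\<^sup>2 * height (act A z)"
      using height_act[OF A(1) z] height_act[OF B z] by simp
    then show "height (act B z) \<le> height (act A z)"
      using denom_nonzero[OF A(1) z] by simp
  qed (use A in blast)
qed

lemma int_square_less_4: "s\<^sup>2 < 4 \<Longrightarrow> s \<in> {-1, 0, 1}" for s :: int
  using power2_less_imp_less[of "\<bar>s\<bar>" 2] by auto

section \<open>Denominators on the region, according to the norm of
  \<open>a\<^sub>1\<^sub>3\<close>\<close>

context ford_ineqs
begin

text \<open>Multiplying by the unit \<open>cnj ?c\<close> normalizes the coefficient of
  \<open>z\<^sub>2\<close> to 1. The null condition then fixes the imaginary part \<open>k\<close>
  and forces \<open>m + n\<close> to be even, as \<open>norm_1_sphere\<close> requires.\<close>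

lemma norm_1_denom:
  assumes z: "z$1 = Complex p q" "z$2 = Complex x y"
    and A: "A \<in> picard_group" "cmod (A$1$3) = 1"
  shows "1 \<le> cmod (denom A z)"
proof -
  let ?c = "A$1$3"
  have cc: "?c * cnj ?c = 1" using A(2) by (simp add: complex_norm_square[symmetric])
  have G: "A$1$j * cnj ?c \<in> gaussian_integers" for j using A by (auto simp: picard_group_def)
  obtain m n :: int where b: "A$1$2 * cnj ?c = Complex m n" using G by (rule gaussian_integersE)
  obtain r k :: int where a: "A$1$1 * cnj ?c = Complex r k" using G by (rule gaussian_integersE)
  have "(cmod (A$1$2 * cnj ?c))\<^sup>2 = 2 * Im (A$1$1 * cnj ?c)"
    using picard_group_row_null[OF A(1)] by (simp only: norm_mult complex_mod_cnj A(2) mult_1_right)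
  then have k: "real_of_int (m\<^sup>2 + n\<^sup>2) = of_int (2 * k)"
    unfolding a b cmod_power2 by simp
  then have "even (m\<^sup>2 + n\<^sup>2)" unfolding of_int_eq_iff by simp
  then have "even (m + n)" by simp
  have "denom A z * cnj ?c = A$1$1 * cnj ?c + (A$1$2 * cnj ?c) * z$1 + (?c * cnj ?c) * z$2"
    by (simp add: denom_def algebra_simps)
  also have "\<dots> = Complex (x + m * p - n * q + r) (y + m * q + n * p + k)"
    unfolding a b cc z by (simp add: complex_eq_iff)
  also have "y + m * q + n * p + k = h + ((m + q)\<^sup>2 + (n + p)\<^sup>2) / 2"
    using k by (simp add: h_def field_simps power2_eq_square)
  finally have "(cmod (denom A z * cnj ?c))\<^sup>2 \<ge> 1"
    using norm_1_sphere[OF \<open>even (m + n)\<close>, of r] by (simp only: cmod_power2 complex.sel)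
  then show ?thesis using A(2) by (simp add: norm_mult one_le_cmod_square_iff)
qed

text \<open>Here \<open>a\<^sub>1\<^sub>3\<close> is an associate of \<open>1 + \<i>\<close>. The
  null condition makes the norm of \<open>a\<^sub>1\<^sub>2\<close> even, so
  \<open>a\<^sub>1\<^sub>2 * cnj a\<^sub>1\<^sub>3\<close> is divisible by 2, and
  \<open>norm_2_sphere\<close> applies after division by 2.\<close>

lemma norm_2_denom:
  assumes z: "z$1 = Complex p q" "z$2 = Complex x y"
    and A: "A \<in> picard_group" "(cmod (A$1$3))\<^sup>2 = 2"
  shows "1 \<le> cmod (denom A z)"
proof -
  have G: "A$1$j \<in> gaussian_integers" for j using A by (auto simp: picard_group_def)
  obtain s t :: int where c: "A$1$3 = Complex s t" using G by (rule gaussian_integersE)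
  obtain e f :: int where b: "A$1$2 = Complex e f" using G by (rule gaussian_integersE)
  obtain g k :: int where a: "A$1$1 = Complex g k" using G by (rule gaussian_integersE)
  have "real_of_int (s\<^sup>2 + t\<^sup>2) = of_int 2" using A(2) by (simp add: c cmod_power2)
  then have st: "s\<^sup>2 + t\<^sup>2 = 2" by (simp only: of_int_eq_iff)
  moreover have "0 \<le> s\<^sup>2" "0 \<le> t\<^sup>2" by simp_all
  ultimately have "s\<^sup>2 < 4" "t\<^sup>2 < 4" by linarith+
  then have "s \<in> {-1, 0, 1}" "t \<in> {-1, 0, 1}" by (simp_all only: int_square_less_4)
  then have st1: "s \<in> {-1, 1}" "t \<in> {-1, 1}" using st by auto
  have "real_of_int (e\<^sup>2 + f\<^sup>2) = of_int (2 * (k * s - g * t))"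
    using picard_group_row_null[OF A(1)] by (simp add: a b c cmod_power2)
  then have ef: "e\<^sup>2 + f\<^sup>2 = 2 * (k * s - g * t)" by (simp only: of_int_eq_iff)
  then have "even (e\<^sup>2 + f\<^sup>2)" by simp
  then have "even (e + f)" by simp
  then have "even (e * s + f * t)" "even (f * s - e * t)" using st1 by auto
  then obtain m n where m: "e * s + f * t = 2 * m" and n: "f * s - e * t = 2 * n" by (elim evenE)
  define r where "r = g * s + k * t"
  have "4 * (m\<^sup>2 + n\<^sup>2) = (e\<^sup>2 + f\<^sup>2) * (s\<^sup>2 + t\<^sup>2)"
    using m n by algebra
  then have mn: "m\<^sup>2 + n\<^sup>2 = k * s - g * t" using ef st by simp
  \<comment> \<open>The sum equals \<open>g * (s - t) + k * (s + t)\<close>, and \<open>s\<close>,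
    \<open>t\<close> are both odd.\<close>
  have "even (r + (k * s - g * t))" using st1 by (auto simp: r_def)
  then have "even (m\<^sup>2 + n\<^sup>2 + r)" unfolding mn by simp
  then have ev: "even (m + n + r)" by simp
  have "denom A z * cnj (A$1$3) = Complex (g * s + k * t) (k * s - g * t)
      + Complex (e * s + f * t) (f * s - e * t) * Complex p q + Complex (s\<^sup>2 + t\<^sup>2) 0 * Complex x y"
    unfolding denom_def a b c z by (simp add: complex_eq_iff algebra_simps power2_eq_square)
  also have "\<dots> = Complex r (m\<^sup>2 + n\<^sup>2) + Complex (2 * m) (2 * n) * Complex p q + Complex 2 0 * Complex x y"
    unfolding mn[symmetric] m n st r_def of_int_mult[symmetric] of_int_add[symmetric] by simp
  also have "\<dots> = Complex (2 * (x + m * p - n * q + r/2)) (2 * (h + ((m + q)\<^sup>2 + (n + p)\<^sup>2) / 2))"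
    by (simp add: complex_eq_iff h_def field_simps power2_eq_square)
  finally have "(cmod (denom A z * cnj (A$1$3)))\<^sup>2
      = 4 * ((x + m * p - n * q + r/2)\<^sup>2 + (h + ((m + q)\<^sup>2 + (n + p)\<^sup>2) / 2)\<^sup>2)"
    by (simp only: cmod_power2 complex.sel power_mult_distrib) simp
  then have "(cmod (denom A z * cnj (A$1$3)))\<^sup>2 \<ge> 2"
    using mult_left_mono[OF norm_2_sphere[OF ev], of 4] by simp
  then have "1 \<le> (cmod (denom A z))\<^sup>2" using A(2) by (simp add: norm_mult power_mult_distrib)
  then show ?thesis by (simp only: one_le_cmod_square_iff)
qed

text \<open>Norm 0 leaves a nonzero Gaussian integer as denominator, norms 1 and 2 are the sphere
  cases, 3 is not a sum of two squares, and from 4 on height at least \<open>1/2\<close> suffices by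
  \<open>height_le_denom\<close>.\<close>

lemma denom_ge_1:
  assumes z: "z$1 = Complex p q" "z$2 = Complex x y" and A: "A \<in> picard_group"
  shows "1 \<le> cmod (denom A z)"
proof -
  have G: "A$1$j \<in> gaussian_integers" for j using A by (auto simp: picard_group_def)
  obtain s t :: int where c: "A$1$3 = Complex s t" using G by (rule gaussian_integersE)
  have norm: "(cmod (A$1$3))\<^sup>2 = of_int (s\<^sup>2 + t\<^sup>2)" by (simp add: c cmod_power2)
  have h: "height z = h" by (simp add: height_def h_def z cmod_power2)
  have D2: "z \<in> D2" using h h_ge_half by (simp add: D2_iff_height)
  have "0 \<le> s\<^sup>2 + t\<^sup>2" by simp
  moreover have "s\<^sup>2 + t\<^sup>2 \<noteq> 3"
  proof
    assume "s\<^sup>2 + t\<^sup>2 = 3"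
    moreover have "0 \<le> s\<^sup>2" "0 \<le> t\<^sup>2" by simp_all
    ultimately have "s\<^sup>2 < 4" "t\<^sup>2 < 4" by linarith+
    then have "s \<in> {-1, 0, 1}" "t \<in> {-1, 0, 1}" by (simp_all only: int_square_less_4)
    then show False using \<open>s\<^sup>2 + t\<^sup>2 = 3\<close> by auto
  qed
  ultimately consider "s\<^sup>2 + t\<^sup>2 = 0" | "s\<^sup>2 + t\<^sup>2 = 1" | "s\<^sup>2 + t\<^sup>2 = 2" | "4 \<le> s\<^sup>2 + t\<^sup>2" by linarith
  then show ?thesis
  proof cases
    case 1
    then have 0: "A$1$3 = 0" using norm by simp
    then have "A$1$2 = 0" using picard_group_row_null[OF A] by simp
    then have "denom A z = A$1$1" using 0 by (simp add: denom_def)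
    then show ?thesis
      using norm_gaussian_integer_ge_1[OF G[of 1]] denom_nonzero[OF A D2] by simp
  next
    case 2
    then have "(cmod (A$1$3))\<^sup>2 = 1" using norm by simp
    then have "cmod (A$1$3) = 1" using power2_eq_imp_eq[of "cmod (A$1$3)" 1] by simp
    then show ?thesis by (rule norm_1_denom[OF z A])
  next
    case 3
    then show ?thesis using norm norm_2_denom[OF z A] by simp
  next
    case 4
    then have "real_of_int 4 \<le> of_int (s\<^sup>2 + t\<^sup>2)" by (simp only: of_int_le_iff)
    then have "2\<^sup>2 \<le> (cmod (A$1$3))\<^sup>2" using norm by simp
    then have "2 \<le> cmod (A$1$3)" by (rule power2_le_imp_le) simp
    then have "2 * (1/2) \<le> cmod (A$1$3) * height z" using h h_ge_half by (intro mult_mono) auto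
    then show ?thesis using height_le_denom[OF A, of z] by simp
  qed
qed

end

section \<open>The matrices of the eight transformations\<close>

definition J_matrix :: "complex^3^3" where
  "J_matrix = vector [vector [0, 0, \<i>], vector [0, -1, 0], vector [-\<i>, 0, 0]]"

text \<open>For a Gaussian unit \<open>u\<close>, this is the rotation
  \<open>z\<^sub>1 \<mapsto> u z\<^sub>1\<close> followed by the Heisenberg translation by
  \<open>(a, b)\<close>, scaled so that the determinant \<open>u^4\<close> is 1.\<close>

definition stab_matrix :: "complex \<Rightarrow> complex \<Rightarrow> complex \<Rightarrow> complex^3^3" where
  "stab_matrix u a b = vector [vector [u, 0, 0],
                               vector [a * u, u\<^sup>2, 0],
                               vector [b * u, \<i> * cnj a * u\<^sup>2, u]]"

definition G_first_matrix :: "int \<Rightarrow> complex^3^3" where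
  "G_first_matrix r = J_matrix ** stab_matrix (-1) (1 + \<i>) (of_int r + \<i>)"

text \<open>The product is given outright because factors such as the dilation by
  \<open>sqrt 2\<close> lie outside the group.\<close>

definition G_second_matrix :: "int \<Rightarrow> complex^3^3" where
  "G_second_matrix r = vector
     [vector [- of_int r * \<i>, of_int r * \<i> - 1, - of_int r - \<i>],
      vector [0, -1, - of_int r - \<i>],
      vector [0, 0, - of_int r * \<i>]]"

definition G_third_matrix :: "int \<Rightarrow> complex^3^3" where
  "G_third_matrix r = vector
     [vector [- of_int r * \<i>, of_int r + \<i>, - of_int r - \<i>],
      vector [0, -1, 1 - of_int r * \<i>],
      vector [0, 0, - of_int r * \<i>]]"

definition G_matrix :: "nat \<Rightarrow> complex^3^3" where
  "G_matrix j = [J_matrix, G_first_matrix (-1), G_first_matrix 0, G_first_matrix 1,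
     G_second_matrix (-1), G_second_matrix 1, G_third_matrix (-1), G_third_matrix 1] ! (j - 1)"

lemmas picard_group_simps = picard_group_def det_3 conj_transpose_def C_form_def
  matrix_matrix_mult_def vec_eq_iff forall_3 sum_3

lemma J_matrix_picard: "J_matrix \<in> picard_group"
  by (simp add: picard_group_simps J_matrix_def)

lemma stab_matrix_picard:
  assumes "u \<in> {1, -1, \<i>, -\<i>}" "a \<in> gaussian_integers" "b \<in> gaussian_integers"
    "(cmod a)\<^sup>2 = 2 * Im b"
  shows "stab_matrix u a b \<in> picard_group"
proof -
  have u: "u \<in> gaussian_integers" "cnj u * u = 1" "(cnj u)\<^sup>2 * u\<^sup>2 = 1" "u * u\<^sup>2 * u = 1"
    using assms(1) by auto
  have "a * cnj a = complex_of_real ((cmod a)\<^sup>2)" by (rule complex_norm_square[symmetric])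
  also have "\<dots> = - \<i> * (b - cnj b)" unfolding assms(4) by (simp add: complex_eq_iff)
  finally have b: "a * cnj a = - \<i> * (b - cnj b)" .
  have "conj_transpose (stab_matrix u a b) ** C_form ** stab_matrix u a b = C_form"
    unfolding vec_eq_iff forall_3
    by (simp add: conj_transpose_def C_form_def matrix_matrix_mult_def sum_3 stab_matrix_def)
       (use u(2,3) b i_squared in \<open>intro conjI; algebra\<close>)
  then show ?thesis
    using u(1,4) assms(2,3) by (simp add: picard_group_def det_3 stab_matrix_def forall_3 power2_eq_square)
qed

lemma G_first_matrix_picard: "G_first_matrix r \<in> picard_group"
  unfolding G_first_matrix_def
  by (intro picard_group_mult J_matrix_picard stab_matrix_picard) (auto simp: cmod_power2)

lemma G_second_matrix_picard: "r \<in> {-1, 1} \<Longrightarrow> G_second_matrix r \<in> picard_group"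
  by (auto simp: picard_group_simps G_second_matrix_def complex_eq_iff gaussian_integers_def)

lemma G_third_matrix_picard: "r \<in> {-1, 1} \<Longrightarrow> G_third_matrix r \<in> picard_group"
  by (auto simp: picard_group_simps G_third_matrix_def complex_eq_iff gaussian_integers_def)

lemma ball_1_8: "(\<forall>j\<in>{1..8::nat}. P j) \<longleftrightarrow> P 1 \<and> P 2 \<and> P 3 \<and> P 4 \<and> P 5 \<and> P 6 \<and> P 7 \<and> P 8"
proof -
  have "{1..8::nat} = {1, 2, 3, 4, 5, 6, 7, 8}" by auto
  then show ?thesis by simp
qed

lemma G_matrix_picard: "\<forall>j\<in>{1..8}. G_matrix j \<in> picard_group"
  unfolding ball_1_8
  by (simp add: G_matrix_def J_matrix_picard G_first_matrix_picard G_second_matrix_picard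
      G_third_matrix_picard)

lemma D2_nonzero: "z \<in> D2 \<Longrightarrow> z$2 \<noteq> 0"
  by (auto simp: D2_def dest: order_le_less_trans[rotated])

lemma act_stab_matrix:
  assumes "u \<in> {1, -1, \<i>, -\<i>}"
  shows "act (stab_matrix u a b) z = vector [u * z$1 + a, z$2 + b + \<i> * cnj a * u * z$1]"
  using assms by (auto simp: act_def stab_matrix_def vec_eq_iff forall_2 field_simps power2_eq_square)

lemma denom_stab_matrix: "denom (stab_matrix u a b) z = u"
  by (simp add: denom_def stab_matrix_def)

lemma J_given_by: "z \<in> D2 \<Longrightarrow> J z = act J_matrix z"
  using D2_nonzero[of z]
  by (simp add: J_def act_def J_matrix_def vec_eq_iff forall_2 field_simps)

lemma G_first_given_by: "given_by (G_first r) (G_first_matrix r)"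
  unfolding given_by_def
proof
  fix z assume z: "z \<in> D2"
  let ?S = "stab_matrix (-1) (1 + \<i>) (of_int r + \<i>)"
  have S: "?S \<in> picard_group" by (intro stab_matrix_picard) (auto simp: cmod_power2)
  have "heis_trans (vector [1 + \<i>, of_int r + \<i>]) (rotation (-1) z) = act ?S z"
    by (simp add: rotation_eq heis_trans_def act_stab_matrix algebra_simps)
  then have "G_first r z = J (act ?S z)" by (simp add: G_first_def)
  also have "\<dots> = act (G_first_matrix r) z"
    using J_given_by[OF act_D2[OF S z]] picard_act_mult(2)[OF J_matrix_picard S z]
    by (simp add: G_first_matrix_def)
  finally show "G_first r z = act (G_first_matrix r) z" .
qed

text \<open>The rotation parameter \<open>\<beta>\<close> is a primitive eighth root of unity, and
  \<open>sqrt 2 / \<beta>^3\<close> is the Gaussian integer \<open>1 - r \<i>\<close>; this removes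
  the square roots.\<close>

lemma dilation_rotation:
  assumes "r \<in> {-1, 1}"
  shows "dilation (sqrt 2) (rotation ((-1 + of_int r * \<i>) / of_real (sqrt 2)) z)
       = vector [(1 - of_int r * \<i>) * z$1, 2 * z$2]"
proof -
  define s where "s = complex_of_real (sqrt 2)"
  have s: "s * s = 2" "s \<noteq> 0" by (simp_all add: s_def of_real_mult[symmetric] del: of_real_mult)
  define \<beta> where "\<beta> = (-1 + of_int r * \<i>) / s"
  have "\<beta> ^ 3 = (-1 + of_int r * \<i>) ^ 3 / (s * s * s)"
    by (simp add: \<beta>_def power_divide power3_eq_cube)
  also have "\<dots> = (1 + of_int r * \<i>) / s"
    using assms s by (auto simp: power3_eq_cube field_simps)
  finally have b3: "\<beta> ^ 3 = (1 + of_int r * \<i>) / s" .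
  have "(1 - of_int r * \<i>) * (1 + of_int r * \<i>) = 2" "1 + of_int r * \<i> \<noteq> 0"
    using assms by (auto simp: algebra_simps complex_eq_iff)
  then have "s * s / (1 + of_int r * \<i>) = 1 - of_int r * \<i>"
    unfolding s(1) by (simp add: divide_eq_eq)
  then have "inverse (\<beta> ^ 3) * s = 1 - of_int r * \<i>"
    unfolding b3 by simp
  moreover have "-1 + of_int r * \<i> \<noteq> 0" by (auto simp: complex_eq_iff)
  then have "\<beta> \<noteq> 0" using s(2) by (simp only: \<beta>_def divide_eq_0_iff) blast
  ultimately show ?thesis
    unfolding s_def[symmetric] \<beta>_def[symmetric]
    by (simp add: dilation_def rotation_eq s_def[symmetric] mult.assoc[symmetric] mult.commute[of s])
qed

lemma divide_unit_mult:
  assumes "r \<in> {-1, 1}"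
  shows "x / ((- of_int r - \<i>) / 2 * w) = x * (- of_int r + \<i>) / w"
proof -
  have "(- of_int r - \<i>) / 2 * (- of_int r + \<i>) = 1" using assms by (auto simp: algebra_simps)
  then have "inverse ((- of_int r - \<i>) / 2) = - of_int r + \<i>" by (rule inverse_unique)
  then show ?thesis
    unfolding divide_inverse[of x] inverse_mult_distrib by (simp only: divide_inverse[of _ w] mult.assoc)
qed

lemma G_second_given_by:
  assumes r: "r \<in> {-1, 1}"
  shows "given_by (G_second r) (G_second_matrix r)"
  unfolding given_by_def
proof
  fix z assume z: "z \<in> D2"
  \<comment> \<open>\<open>w\<close> is the second coordinate of the point to which \<open>J\<close>
    is applied, and equals the denominator of the matrix up to a constant factor.\<close>
  define w where "w = 2 * z$2 + of_int r + \<i> - 2 * \<i> * z$1"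
  have "2 * denom (G_second_matrix r) z = (- of_int r - \<i>) * w"
    using r by (auto simp: denom_def G_second_matrix_def w_def complex_eq_iff algebra_simps)
  then have d: "denom (G_second_matrix r) z = (- of_int r - \<i>) / 2 * w"
    by (simp add: field_simps)
  have w: "w \<noteq> 0" using denom_nonzero[OF G_second_matrix_picard[OF r] z] d by auto
  have "heis_trans (vector [-1 + of_int r * \<i>, of_int r + \<i>]) (vector [(1 - of_int r * \<i>) * z$1, 2 * z$2])
      = vector [(1 - of_int r * \<i>) * (z$1 - 1), w]"
    using r by (auto simp: heis_trans_def w_def vec_eq_iff forall_2 algebra_simps)
  then have "G_second r z = heis_trans (vector [1, (of_int r + \<i>) / 2])
      (vector [\<i> * ((1 - of_int r * \<i>) * (z$1 - 1)) / w, - 1 / w])"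
    by (simp only: G_second_def o_apply dilation_rotation[OF r]) (simp add: J_def)
  also have "\<dots> = act (G_second_matrix r) z"
    unfolding vec_eq_iff forall_2 act_nth d hom_coord_mult divide_unit_mult[OF r]
    using w r by (auto simp: heis_trans_def G_second_matrix_def field_simps) (auto simp: w_def algebra_simps)
  finally show "G_second r z = act (G_second_matrix r) z" .
qed

lemma G_third_given_by:
  assumes r: "r \<in> {-1, 1}"
  shows "given_by (G_third r) (G_third_matrix r)"
  unfolding given_by_def
proof
  fix z assume z: "z \<in> D2"
  define w where "w = 2 * z$2 + of_int r + \<i> - 2 * z$1"
  have "2 * denom (G_third_matrix r) z = (- of_int r - \<i>) * w"
    using r by (auto simp: denom_def G_third_matrix_def w_def complex_eq_iff algebra_simps)
  then have d: "denom (G_third_matrix r) z = (- of_int r - \<i>) / 2 * w"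
    by (simp add: field_simps)
  have w: "w \<noteq> 0" using denom_nonzero[OF G_third_matrix_picard[OF r] z] d by auto
  have "heis_trans (vector [- of_int r - \<i>, of_int r + \<i>]) (vector [(1 - of_int r * \<i>) * z$1, 2 * z$2])
      = vector [(1 - of_int r * \<i>) * (z$1 - \<i>), w]"
    using r by (auto simp: heis_trans_def w_def vec_eq_iff forall_2 algebra_simps)
  then have "G_third r z = heis_trans (vector [\<i>, (of_int r + \<i>) / 2])
      (vector [\<i> * ((1 - of_int r * \<i>) * (z$1 - \<i>)) / w, - 1 / w])"
    by (simp only: G_third_def o_apply dilation_rotation[OF r]) (simp add: J_def)
  also have "\<dots> = act (G_third_matrix r) z"
    unfolding vec_eq_iff forall_2 act_nth d hom_coord_mult divide_unit_mult[OF r]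
    using w r by (auto simp: heis_trans_def G_third_matrix_def field_simps) (auto simp: w_def algebra_simps)
  finally show "G_third r z = act (G_third_matrix r) z" .
qed

lemma G_given_by: "\<forall>j\<in>{1..8}. given_by (G j) (G_matrix j)"
  unfolding ball_1_8
  by (simp add: G_matrix_def G_def G_first_given_by G_second_given_by G_third_given_by)
     (simp add: given_by_def J_given_by)

section \<open>The conditions of the region as explicit spheres\<close>

lemma cmod_denom_G_matrix:
  fixes z :: "complex^2"
  defines "p \<equiv> Re (z$1)" and "q \<equiv> Im (z$1)" and "x \<equiv> Re (z$2)" and "y \<equiv> Im (z$2)"
  shows "(cmod (denom J_matrix z))\<^sup>2 = x\<^sup>2 + y\<^sup>2"
    and "(cmod (denom (G_first_matrix r) z))\<^sup>2 = (x + r - p + q)\<^sup>2 + (y + 1 - p - q)\<^sup>2"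
    and "r \<in> {-1, 1} \<Longrightarrow>
      (cmod (denom (G_second_matrix r) z))\<^sup>2 = 2 * ((x + q + r/2)\<^sup>2 + (y - p + 1/2)\<^sup>2)"
    and "r \<in> {-1, 1} \<Longrightarrow>
      (cmod (denom (G_third_matrix r) z))\<^sup>2 = 2 * ((x - p + r/2)\<^sup>2 + (y - q + 1/2)\<^sup>2)"
  unfolding assms
  by (auto simp: denom_def J_matrix_def G_first_matrix_def G_second_matrix_def G_third_matrix_def
      stab_matrix_def matrix_matrix_mult_def sum_3 cmod_power2)
     (auto simp: power2_eq_square field_simps)

text \<open>The squared modulus of the Jacobian is the inverse sixth power of that of the
  denominator; for \<open>j = 1\<close> the denominator has the modulus of
  \<open>z\<^sub>2\<close>.\<close>

lemma G_condition_iff: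
  assumes j: "j \<in> {1..8}" and z: "z \<in> D2"
  shows "G_condition j z \<longleftrightarrow> 1 \<le> cmod (denom (G_matrix j) z)"
proof (cases "j = 1")
  case True
  have "cmod (denom (G_matrix 1) z) = cmod (z$2)"
    by (simp add: G_matrix_def denom_def J_matrix_def norm_mult)
  then show ?thesis using True by (simp add: G_condition_def one_le_cmod_square_iff)
next
  case False
  have A: "G_matrix j \<in> picard_group" and f: "given_by (G j) (G_matrix j)"
    using j G_matrix_picard G_given_by by blast+
  define d where "d = cmod (denom (G_matrix j) z)"
  have d: "0 < d" using denom_nonzero[OF A z] by (simp add: d_def)
  have "cmod (complex_jacobian_det (G j) z) = 1 / d ^ 3"
    unfolding complex_jacobian_det_given_by[OF A f z] by (simp add: d_def norm_divide norm_power)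
  then have "G_condition j z \<longleftrightarrow> (1 / d ^ 3)\<^sup>2 \<le> 1" using False by (simp add: G_condition_def)
  also have "\<dots> \<longleftrightarrow> 1 \<le> d ^ 6" using d by (simp add: power_divide divide_le_eq power_mult[symmetric])
  also have "\<dots> \<longleftrightarrow> 1 \<le> d" using d power_mono_iff[of 1 d 6] by simp
  finally show ?thesis by (simp add: d_def)
qed

definition sphere_condition :: "nat \<Rightarrow> real \<Rightarrow> real \<Rightarrow> real \<Rightarrow> real \<Rightarrow> bool" where
  "sphere_condition j p q x y \<longleftrightarrow>
    [x\<^sup>2 + y\<^sup>2 \<ge> 1,
     (x - 1 - p + q)\<^sup>2 + (y + 1 - p - q)\<^sup>2 \<ge> 1,
     (x - p + q)\<^sup>2 + (y + 1 - p - q)\<^sup>2 \<ge> 1,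
     (x + 1 - p + q)\<^sup>2 + (y + 1 - p - q)\<^sup>2 \<ge> 1,
     (x + q - 1/2)\<^sup>2 + (y - p + 1/2)\<^sup>2 \<ge> 1/2,
     (x + q + 1/2)\<^sup>2 + (y - p + 1/2)\<^sup>2 \<ge> 1/2,
     (x - p - 1/2)\<^sup>2 + (y - q + 1/2)\<^sup>2 \<ge> 1/2,
     (x - p + 1/2)\<^sup>2 + (y - q + 1/2)\<^sup>2 \<ge> 1/2] ! (j - 1)"

lemma G_condition_sphere:
  assumes z: "z \<in> D2"
  shows "\<forall>j\<in>{1..8}. G_condition j z \<longleftrightarrow> sphere_condition j (Re (z$1)) (Im (z$1)) (Re (z$2)) (Im (z$2))"
proof -
  have half: "1 \<le> 2 * t \<longleftrightarrow> 1/2 \<le> t" for t :: real by auto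
  have "\<forall>j\<in>{1..8}. 1 \<le> (cmod (denom (G_matrix j) z))\<^sup>2
      \<longleftrightarrow> sphere_condition j (Re (z$1)) (Im (z$1)) (Re (z$2)) (Im (z$2))"
    unfolding ball_1_8 sphere_condition_def
    by (simp add: G_matrix_def cmod_denom_G_matrix half) (simp add: mult.commute)
  then show ?thesis using G_condition_iff[OF _ z] by (simp add: one_le_cmod_square_iff)
qed

lemma picard_region_eq:
  assumes "S \<subseteq> {1..8}"
  shows "z \<in> picard_region S \<longleftrightarrow> z \<in> D2 \<and> 0 \<le> Re (z$1) \<and> 0 \<le> Im (z$1) \<and> Re (z$1) + Im (z$1) \<le> 1
     \<and> \<bar>Re (z$2)\<bar> \<le> 1/2 \<and> (\<forall>j\<in>S. sphere_condition j (Re (z$1)) (Im (z$1)) (Re (z$2)) (Im (z$2)))"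
proof -
  have "(\<forall>j\<in>S. G_condition j z)
      \<longleftrightarrow> (\<forall>j\<in>S. sphere_condition j (Re (z$1)) (Im (z$1)) (Re (z$2)) (Im (z$2)))" if "z \<in> D2"
    using G_condition_sphere[OF that] assms by blast
  then show ?thesis unfolding picard_region_def mem_Collect_eq by blast
qed

lemma picard_region_subset_D2: "picard_region S \<subseteq> D2"
  by (auto simp: picard_region_def)

lemma region_ford_ineqs:
  assumes "z \<in> picard_region {1..8}"
  shows "ford_ineqs (Re (z$1)) (Im (z$1)) (Re (z$2)) (Im (z$2))"
proof -
  have z: "z \<in> D2" "0 \<le> Re (z$1)" "0 \<le> Im (z$1)" "Re (z$1) + Im (z$1) \<le> 1" "\<bar>Re (z$2)\<bar> \<le> 1/2"
    and "\<forall>j\<in>{1..8}. sphere_condition j (Re (z$1)) (Im (z$1)) (Re (z$2)) (Im (z$2))"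
    using assms picard_region_eq[of "{1..8}" z] by blast+
  note s = this(6)[unfolded ball_1_8 sphere_condition_def, simplified]
  have "Im (z$2) > ((Re (z$1))\<^sup>2 + (Im (z$1))\<^sup>2) / 2" using z(1) by (simp add: D2_def cmod_power2)
  then show ?thesis using z s by unfold_locales auto
qed

lemma denom_ge_1_region:
  assumes "z \<in> picard_region {1..8}" "A \<in> picard_group"
  shows "1 \<le> cmod (denom A z)"
  using ford_ineqs.denom_ge_1[OF region_ford_ineqs[OF assms(1)] _ _ assms(2)] by simp

section \<open>Dilation parameters\<close>

lemma cmod_denom_eq_if_act_eq:
  assumes "A \<in> picard_group" "B \<in> picard_group" "z \<in> D2" "act A z = act B z"
  shows "cmod (denom A z) = cmod (denom B z)"
proof -
  have "height (act B z) > 0" using act_D2[OF assms(2,3)] by (simp add: D2_iff_height)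
  moreover have "(cmod (denom A z))\<^sup>2 * height (act B z) = (cmod (denom B z))\<^sup>2 * height (act B z)"
    using height_act[OF assms(1,3)] height_act[OF assms(2,3)] assms(4) by simp
  ultimately show ?thesis by simp
qed

lemma cmod_13_eq_if_act_eq:
  assumes "A \<in> picard_group" "B \<in> picard_group" "\<And>z. z \<in> D2 \<Longrightarrow> act A z = act B z"
  shows "cmod (A$1$3) = cmod (B$1$3)"
proof -
  \<comment> \<open>Along \<open>(0, it)\<close> the squared modulus of the denominator is quadratic in \<open>t\<close> with leading
      coefficient \<open>\<bar>a\<^sub>1\<^sub>3\<bar>\<^sup>2\<close>, which a second difference extracts.\<close>
  define w :: "real \<Rightarrow> complex^2" where "w t = vector [0, \<i> * of_real t]" for t
  have eq: "(cmod (denom A (w t)))\<^sup>2 = (cmod (denom B (w t)))\<^sup>2" if "0 < t" for t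
    using cmod_denom_eq_if_act_eq[OF assms(1,2) _ assms(3), of "w t"] that by (simp add: w_def D2_def)
  have diff: "(cmod (denom M (w 3)))\<^sup>2 - 2 * (cmod (denom M (w 2)))\<^sup>2 + (cmod (denom M (w 1)))\<^sup>2
      = 2 * (cmod (M$1$3))\<^sup>2" for M
    by (simp add: denom_def w_def cmod_power2) (simp add: power2_eq_square algebra_simps)
  have "(cmod (A$1$3))\<^sup>2 = (cmod (B$1$3))\<^sup>2" using diff[of A] diff[of B] eq by simp
  then show ?thesis by simp
qed

lemma has_dilation_parameter_given_by:
  assumes A: "A \<in> picard_group" and f: "given_by f A" and "cmod (A$1$3) = \<delta>" "\<delta> \<noteq> 0"
  shows "has_dilation_parameter f \<delta>"
  unfolding has_dilation_parameter_def
proof (intro conjI ballI impI)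
  show "in_picard f" using in_picard_if_given_by[OF A f] .
  fix B assume "B \<in> picard_group" "given_by f B"
  then have "cmod (B$1$3) = cmod (A$1$3)"
    using f by (intro cmod_13_eq_if_act_eq A) (auto simp: given_by_def)
  then show "cmod (B$1$3) = \<delta>" "B$1$3 \<noteq> 0" using assms(3,4) by auto
qed

lemma cmod_G_matrix_13:
  "\<forall>j\<in>{1..8}. cmod (G_matrix j$1$3) = (if j \<le> 4 then 1 else sqrt 2)"
  unfolding ball_1_8
  by (simp add: G_matrix_def J_matrix_def G_first_matrix_def G_second_matrix_def G_third_matrix_def
      stab_matrix_def matrix_matrix_mult_def sum_3 cmod_def)

section \<open>The fundamental domain\<close>

lemma ex_rotation_into_triangle:
  fixes w :: complex
  obtains u a m where "u \<in> {1, -1, \<i>, -\<i>}" "a \<in> gaussian_integers" "(cmod a)\<^sup>2 = 2 * of_int m"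
    "0 \<le> Re (u * w + a)" "0 \<le> Im (u * w + a)" "Re (u * w + a) + Im (u * w + a) \<le> 1"
proof -
  \<comment> \<open>The translation lattice is spanned by \<open>1 + \<i>\<close> and \<open>1 - \<i>\<close>; reducing modulo it leads into the
      square \<open>\<bar>Re v\<bar> + \<bar>Im v\<bar> \<le> 1\<close>, which the four rotations map onto the triangle.\<close>
  define k l where "k = round ((Re w + Im w) / 2)" and "l = round ((Re w - Im w) / 2)"
  define c where "c = Complex (of_int (k + l)) (of_int (k - l))"
  define v where "v = w - c"
  have "\<bar>Re w + Im w - 2 * k\<bar> \<le> 1" "\<bar>Re w - Im w - 2 * l\<bar> \<le> 1"
    using of_int_round_abs_le[of "(Re w + Im w) / 2"] of_int_round_abs_le[of "(Re w - Im w) / 2"]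
    by (auto simp: k_def l_def abs_le_iff field_simps)
  then have v: "\<bar>Re v + Im v\<bar> \<le> 1" "\<bar>Re v - Im v\<bar> \<le> 1" by (auto simp: v_def c_def)
  have c: "c \<in> gaussian_integers" by (simp add: c_def gaussian_integers_def)
  have norm_c: "(cmod c)\<^sup>2 = 2 * of_int (k\<^sup>2 + l\<^sup>2)"
    unfolding c_def cmod_power2 by (simp add: power2_eq_square algebra_simps)
  obtain u where u: "u \<in> {1, -1, \<i>, -\<i>}"
    and tri: "0 \<le> Re (u * v)" "0 \<le> Im (u * v)" "Re (u * v) + Im (u * v) \<le> 1"
  proof (cases "0 \<le> Re v")
    case True
    then show thesis
      using v that[of 1] that[of \<i>] by (cases "0 \<le> Im v") auto
  next
    case False
    then show thesis
      using v that[of "-1"] that[of "-\<i>"] by (cases "0 \<le> Im v") auto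
  qed
  have "u \<in> gaussian_integers" "cmod u = 1" using u by auto
  then have "- (u * c) \<in> gaussian_integers" "(cmod (- (u * c)))\<^sup>2 = 2 * of_int (k\<^sup>2 + l\<^sup>2)"
    using c norm_c by (auto simp: norm_mult)
  moreover have "u * w + - (u * c) = u * v" by (simp add: v_def algebra_simps)
  ultimately show thesis using that[of u "- (u * c)" "k\<^sup>2 + l\<^sup>2"] u tri by simp
qed

text \<open>Evenness of the norm of \<open>a\<close> lets \<open>b\<close> have the integral
  imaginary part \<open>m\<close> that the null condition demands. The real part of \<open>b\<close>
  stays free and is used to round \<open>Re z\<^sub>2\<close> into the strip.\<close>

lemma ex_stabilizer_into_strip:
  obtains S where "S \<in> picard_group" "\<And>w. cmod (denom S w) = 1"
    "0 \<le> Re (act S z$1)" "0 \<le> Im (act S z$1)" "Re (act S z$1) + Im (act S z$1) \<le> 1"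
    "\<bar>Re (act S z$2)\<bar> \<le> 1/2"
proof -
  obtain u a m where u: "u \<in> {1, -1, \<i>, -\<i>}" and a: "a \<in> gaussian_integers" "(cmod a)\<^sup>2 = 2 * of_int m"
    and tri: "0 \<le> Re (u * z$1 + a)" "0 \<le> Im (u * z$1 + a)" "Re (u * z$1 + a) + Im (u * z$1 + a) \<le> 1"
    by (rule ex_rotation_into_triangle)
  define x where "x = Re (z$2 + \<i> * cnj a * u * z$1)"
  define b where "b = Complex (of_int (- round x)) (of_int m)"
  have "\<bar>x - of_int (round x)\<bar> \<le> 1/2" using of_int_round_abs_le[of x] by (simp add: abs_minus_commute)
  then have "\<bar>Re (z$2 + b + \<i> * cnj a * u * z$1)\<bar> \<le> 1/2" by (simp add: b_def x_def algebra_simps)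
  moreover have "stab_matrix u a b \<in> picard_group"
    using u a by (intro stab_matrix_picard) (auto simp: b_def gaussian_integers_def)
  moreover have "cmod u = 1" using u by auto
  ultimately show thesis
    using tri that[of "stab_matrix u a b"] by (simp add: act_stab_matrix[OF u] denom_stab_matrix)
qed

lemma ex_act_in_region:
  assumes z: "z \<in> D2"
  shows "\<exists>A\<in>picard_group. act A z \<in> picard_region {1..8}"
proof -
  obtain A where A: "A \<in> picard_group"
    and max: "\<And>B. B \<in> picard_group \<Longrightarrow> height (act B z) \<le> height (act A z)"
    using ex_max_height[OF z] by blast
  obtain S where S: "S \<in> picard_group" "\<And>w. cmod (denom S w) = 1"
    and strip: "0 \<le> Re (act S (act A z)$1)" "0 \<le> Im (act S (act A z)$1)"
      "Re (act S (act A z)$1) + Im (act S (act A z)$1) \<le> 1" "\<bar>Re (act S (act A z)$2)\<bar> \<le> 1/2"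
    using ex_stabilizer_into_strip[of "act A z"] by blast
  define w where "w = act S (act A z)"
  have SA: "S ** A \<in> picard_group" using picard_group_mult S(1) A by blast
  have w: "w = act (S ** A) z" using picard_act_mult(2)[OF S(1) A z] by (simp add: w_def)
  have wD: "w \<in> D2" unfolding w using act_D2[OF SA z] .
  have hw: "height w = height (act A z)"
    using height_act[OF S(1) act_D2[OF A z]] S(2) by (simp add: w_def)
  have "1 \<le> cmod (denom B w)" if B: "B \<in> picard_group" for B
  proof -
    have "height (act B w) = height (act (B ** (S ** A)) z)"
      using picard_act_mult(2)[OF B SA z] by (simp add: w)
    also have "\<dots> \<le> height w" unfolding hw using max picard_group_mult[OF B SA] by blast
    finally have le: "height (act B w) \<le> height w" .
    have pos: "0 < height (act B w)" using act_D2[OF B wD] by (simp add: D2_iff_height)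
    have "1 * height (act B w) \<le> (cmod (denom B w))\<^sup>2 * height (act B w)"
      using height_act[OF B wD] le by simp
    then have "1 \<le> (cmod (denom B w))\<^sup>2" using pos by (simp only: mult_le_cancel_right_pos)
    then show ?thesis by (simp only: one_le_cmod_square_iff)
  qed
  then have "\<forall>j\<in>{1..8}. G_condition j w" using G_condition_iff[OF _ wD] G_matrix_picard by blast
  then have "w \<in> picard_region {1..8}" using wD strip by (simp add: picard_region_def w_def)
  then show ?thesis using SA w by blast
qed

section \<open>Identified points lie on the frontier\<close>

lemma ex_line_in_interior:
  fixes z :: "'a::real_normed_vector"
  assumes "z \<in> interior S"
  obtains e where "0 < e" "\<And>t. \<bar>t\<bar> \<le> e \<Longrightarrow> z + t *\<^sub>R v \<in> S"
proof -
  have "isCont (\<lambda>t. z + t *\<^sub>R v) 0" by (intro continuous_intros)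
  then have "((\<lambda>t. z + t *\<^sub>R v) \<longlongrightarrow> z) (at 0)" by (simp add: isCont_def)
  then have "\<forall>\<^sub>F t in at 0. z + t *\<^sub>R v \<in> interior S"
    using assms topological_tendstoD open_interior by blast
  then obtain d where d: "0 < d" "\<And>t. t \<noteq> 0 \<Longrightarrow> dist t 0 < d \<Longrightarrow> z + t *\<^sub>R v \<in> interior S"
    unfolding eventually_at by auto
  have "z + t *\<^sub>R v \<in> S" if "\<bar>t\<bar> \<le> d / 2" for t
    using d(1) d(2)[of t] that assms interior_subset[of S] by (cases "t = 0") auto
  then show thesis using that[of "d / 2"] d(1) by simp
qed

lemma interior_region_strict:
  assumes z: "z \<in> interior (picard_region {1..8})"
  shows "0 < Re (z$1)" "0 < Im (z$1)" "Re (z$1) + Im (z$1) < 1" "\<bar>Re (z$2)\<bar> < 1/2"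
proof -
  have R: "w \<in> picard_region {1..8} \<Longrightarrow> 0 \<le> Re (w$1) \<and> 0 \<le> Im (w$1) \<and> Re (w$1) + Im (w$1) \<le> 1
      \<and> \<bar>Re (w$2)\<bar> \<le> 1/2" for w
    by (simp add: picard_region_def)
  \<comment> \<open>Moving both ways along \<open>(1, 1)\<close> gives every strict inequality
    except \<open>0 < Im z\<^sub>1\<close>, for which the direction \<open>(\<i>, 0)\<close> is
    used.\<close>
  obtain e where e: "0 < e" "\<And>t. \<bar>t\<bar> \<le> e \<Longrightarrow> z + t *\<^sub>R vector [1, 1] \<in> picard_region {1..8}"
    using ex_line_in_interior[OF z] by blast
  obtain f where f: "0 < f" "\<And>t. \<bar>t\<bar> \<le> f \<Longrightarrow> z + t *\<^sub>R vector [\<i>, 0] \<in> picard_region {1..8}"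
    using ex_line_in_interior[OF z] by blast
  have e1: "\<bar>Re (z$2) + e\<bar> \<le> 1/2" "Re (z$1) + e + Im (z$1) \<le> 1" using R[OF e(2)[of e]] e(1) by auto
  have e2: "\<bar>Re (z$2) - e\<bar> \<le> 1/2" "0 \<le> Re (z$1) - e" using R[OF e(2)[of "-e"]] e(1) by auto
  have f1: "0 \<le> Im (z$1) - f" using R[OF f(2)[of "-f"]] f(1) by auto
  show "0 < Re (z$1)" "0 < Im (z$1)" "Re (z$1) + Im (z$1) < 1" "\<bar>Re (z$2)\<bar> < 1/2"
    using e1 e2 f1 e(1) f(1) by linarith+
qed

text \<open>The triangle is a fundamental domain for rotations by Gaussian units combined with
  translations of even coordinate sum: quarter turns would force \<open>s + t = 1\<close>, against
  parity, and the half turn \<open>s, t \<ge> 1\<close> with \<open>s + t < 2\<close>.\<close>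

lemma triangle_rotation_trivial:
  fixes w :: complex and s t :: int
  assumes w: "0 < Re w" "0 < Im w" "Re w + Im w < 1"
    and v: "0 \<le> Re (u * w + Complex s t)" "0 \<le> Im (u * w + Complex s t)"
      "Re (u * w + Complex s t) + Im (u * w + Complex s t) \<le> 1"
    and u: "u \<in> {1, -1, \<i>, -\<i>}" and ev: "even (s + t)"
  shows "u = 1" "s = 0" "t = 0"
proof -
  have "u = 1 \<and> s = 0 \<and> t = 0"
  proof -
    consider "u = 1" | "u = -1" | "u = \<i>" | "u = -\<i>" using u by auto
    then show ?thesis
    proof cases
      case 1
      then have "-1 < real_of_int s" "real_of_int s < 1" "-1 < real_of_int t" "real_of_int t < 1"
        using w v by auto
      then show ?thesis using 1 by auto
    next
      case 2
      then have "0 < real_of_int s" "0 < real_of_int t" "real_of_int (s + t) < 2" using w v by auto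
      then have "1 \<le> s" "1 \<le> t" "s + t < 2" by linarith+
      then have False by linarith
      then show ?thesis ..
    next
      case 3
      then have "0 < real_of_int s" "-1 < real_of_int t" "real_of_int (s + t) < 2" using w v by auto
      then have "1 \<le> s" "0 \<le> t" "s + t < 2" by linarith+
      then have "s + t = 1" by linarith
      then show ?thesis using ev by simp
    next
      case 4
      then have "-1 < real_of_int s" "0 < real_of_int t" "real_of_int (s + t) < 2" using w v by auto
      then have "0 \<le> s" "1 \<le> t" "s + t < 2" by linarith+
      then have "s + t = 1" by linarith
      then show ?thesis using ev by simp
    qed
  qed
  then show "u = 1" "s = 0" "t = 0" by auto
qed

lemma gaussian_unit:
  assumes "u \<in> gaussian_integers" "cmod u = 1"
  shows "u \<in> {1, -1, \<i>, -\<i>}"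
proof -
  obtain s t :: int where u: "u = Complex s t" using assms(1) by (rule gaussian_integersE)
  have "(cmod u)\<^sup>2 = 1" using assms(2) by simp
  then have "real_of_int (s\<^sup>2 + t\<^sup>2) = of_int 1" unfolding u cmod_power2 by simp
  then have st: "s\<^sup>2 + t\<^sup>2 = 1" by (simp only: of_int_eq_iff)
  moreover have "0 \<le> s\<^sup>2" "0 \<le> t\<^sup>2" by simp_all
  ultimately have "s\<^sup>2 < 4" "t\<^sup>2 < 4" by linarith+
  then have "s \<in> {-1, 0, 1}" "t \<in> {-1, 0, 1}" by (simp_all only: int_square_less_4)
  then show ?thesis using st by (auto simp: u complex_eq_iff)
qed

lemma picard_columns:
  assumes "A \<in> picard_group"
  shows "cnj (A$1$j) * \<i> * A$3$k + cnj (A$2$j) * A$2$k - \<i> * cnj (A$3$j) * A$1$k = C_form$j$k"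
proof -
  have "(conj_transpose A ** C_form ** A)$j$k = C_form$j$k"
    using assms by (simp add: picard_group_def)
  then show ?thesis
    by (simp add: conj_transpose_def matrix_matrix_mult_def sum_3 C_form_def algebra_simps)
qed

text \<open>A matrix fixing infinity is lower triangular with units on the diagonal. Its action on
  \<open>z\<^sub>1\<close> is trivial by \<open>triangle_rotation_trivial\<close>; what remains is a
  translation of \<open>z\<^sub>2\<close> by an integer, which the strip excludes.\<close>

lemma stabilizer_trivial:
  assumes A: "A \<in> picard_group" "A$1$3 = 0"
    and z: "z \<in> interior (picard_region {1..8})" "act A z \<in> picard_region {1..8}"
  shows "A = mat 1"
proof -
  have G: "A$j$k \<in> gaussian_integers" for j k using A(1) by (simp add: picard_group_def)
  have A12: "A$1$2 = 0" using picard_group_row_null[OF A(1)] A(2) by simp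
  have "cnj (A$2$3) * A$2$3 = 0" using picard_columns[OF A(1), of 3 3] A(2) by (simp add: C_form_def)
  then have A23: "A$2$3 = 0" by simp
  have A13: "cnj (A$1$1) * A$3$3 = 1"
    using picard_columns[OF A(1), of 1 3] A(2) A23 by (simp add: C_form_def)
  then have "A$1$1 \<noteq> 0" "A$3$3 \<noteq> 0" by auto
  then have "1 \<le> cmod (A$1$1)" "1 \<le> cmod (A$3$3)" using norm_gaussian_integer_ge_1 G by auto
  moreover have "cmod (A$1$1) * cmod (A$3$3) = 1" using arg_cong[OF A13, of cmod] by (simp add: norm_mult)
  ultimately have n1: "cmod (A$1$1) = 1"
    using mult_left_mono[of 1 "cmod (A$3$3)" "cmod (A$1$1)"] by simp
  then have u1: "A$1$1 \<in> {1, -1, \<i>, -\<i>}" using gaussian_unit G by blast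
  have c1: "cnj (A$1$1) * A$1$1 = 1" using u1 by auto
  have A33: "A$3$3 = A$1$1" using A13 c1 \<open>A$1$1 \<noteq> 0\<close>
    by (metis complex_cnj_zero_iff mult_cancel_left)
  have det: "A$1$1 * A$2$2 * A$3$3 = 1"
    using A A12 A23 by (simp add: picard_group_def det_3)
  have n2: "cmod (A$2$2) = 1" using arg_cong[OF det, of cmod] n1 by (simp add: norm_mult A33)
  define u where "u = A$2$2 * cnj (A$1$1)"
  have u: "u \<in> {1, -1, \<i>, -\<i>}" unfolding u_def
    by (intro gaussian_unit) (auto simp: G norm_mult n1 n2)
  obtain s t :: int where a: "A$2$1 * cnj (A$1$1) = Complex s t"
    by (rule gaussian_integersE[of "A$2$1 * cnj (A$1$1)"]) (use G in auto)
  have den: "denom A z = A$1$1" by (simp add: denom_def A(2) A12)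
  have inv: "x / A$1$1 = x * cnj (A$1$1)" for x
    using c1 \<open>A$1$1 \<noteq> 0\<close> by (simp add: field_simps)
  have act1: "act A z$1 = u * z$1 + Complex s t"
    unfolding act_nth den inv hom_coord_mult a[symmetric] by (simp add: A23 u_def algebra_simps)
  obtain g k :: int where b: "cnj (A$1$1) * A$3$1 = Complex g k"
    by (rule gaussian_integersE[of "cnj (A$1$1) * A$3$1"]) (use G in auto)
  have null: "(cmod (A$2$1))\<^sup>2 = 2 * k"
  proof -
    have "cnj (A$1$1) * \<i> * A$3$1 + cnj (A$2$1) * A$2$1 - \<i> * cnj (A$3$1) * A$1$1 = 0"
      using picard_columns[OF A(1), of 1 1] by (simp add: C_form_def)
    moreover have "cnj (A$2$1) * A$2$1 = of_real ((cmod (A$2$1))\<^sup>2)"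
      by (simp only: complex_norm_square mult.commute)
    moreover have "cnj (A$1$1) * \<i> * A$3$1 = \<i> * Complex g k" "\<i> * cnj (A$3$1) * A$1$1 = \<i> * cnj (Complex g k)"
      unfolding b[symmetric] by (simp_all add: algebra_simps)
    ultimately show ?thesis by (simp add: complex_eq_iff)
  qed
  have "(cmod (A$2$1))\<^sup>2 = (cmod (A$2$1 * cnj (A$1$1)))\<^sup>2" by (simp add: norm_mult n1)
  then have "real_of_int (s\<^sup>2 + t\<^sup>2) = of_int (2 * k)" using null by (simp add: a cmod_power2)
  then have "even (s\<^sup>2 + t\<^sup>2)" unfolding of_int_eq_iff by simp
  then have ev: "even (s + t)" by simp
  have tri: "0 \<le> Re (act A z$1)" "0 \<le> Im (act A z$1)" "Re (act A z$1) + Im (act A z$1) \<le> 1"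
    "\<bar>Re (act A z$2)\<bar> \<le> 1/2"
    using z(2) by (auto simp: picard_region_def)
  note triv = triangle_rotation_trivial[OF interior_region_strict(1-3)[OF z(1)] tri(1-3)[unfolded act1] u ev]
  have "A$2$2 = u * A$1$1" by (simp add: u_def mult.assoc c1)
  then have A22: "A$2$2 = A$1$1" by (simp add: triv(1))
  have A21: "A$2$1 = 0" using a \<open>A$1$1 \<noteq> 0\<close> by (auto simp: triv(2,3) zero_complex.code[symmetric])
  \<comment> \<open>All diagonal entries are now equal, so \<open>A$1$1\<close> is a Gaussian unit
    with cube 1.\<close>
  have A11: "A$1$1 = 1" using det u1 by (auto simp: A22 A33 complex_eq_iff[of "- \<i>"])
  have A32: "A$3$2 = 0" using picard_columns[OF A(1), of 1 2] by (simp add: C_form_def A11 A12 A21)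
  have "k = 0" using null A21 by simp
  then have A31: "A$3$1 = of_int g" using b A11 by (simp add: complex_eq_iff)
  have "act A z$2 = of_int g + z$2" unfolding act_nth den hom_coord_mult by (simp add: A11 A31 A32 A33)
  then have "Re (act A z$2) = of_int g + Re (z$2)" by simp
  then have "\<bar>real_of_int g\<bar> < 1" using tri(4) interior_region_strict(4)[OF z(1)] by linarith
  then have "g = 0" by linarith
  then show ?thesis
    by (simp add: vec_eq_iff forall_3 mat_def A11 A(2) A12 A21 A22 A23 A31 A32 A33)
qed

lemma frontier_if_act_in_region:
  assumes z: "z \<in> picard_region {1..8}" and A: "A \<in> picard_group" "A \<noteq> mat 1"
    and Az: "act A z \<in> picard_region {1..8}"
  shows "z \<in> frontier (picard_region {1..8})"
proof (rule ccontr)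
  assume "\<not> ?thesis"
  then have int: "z \<in> interior (picard_region {1..8})"
    using z closure_subset[of "picard_region {1..8}"] by (auto simp: frontier_def)
  then have c: "A$1$3 \<noteq> 0" using stabilizer_trivial A Az by blast
  have D: "z \<in> D2" using z by (simp add: picard_region_def)
  have "denom A z * denom (picard_inverse A) (act A z) = 1"
    using picard_act_mult(1)[OF picard_group_inverse[OF A(1)] A(1) D] picard_inverse_left[OF A(1)] by simp
  then have "cmod (denom A z) * cmod (denom (picard_inverse A) (act A z)) = 1"
    by (metis norm_mult norm_one)
  moreover have "1 \<le> cmod (denom (picard_inverse A) (act A z))" "1 \<le> cmod (denom A z)"
    using denom_ge_1_region[OF Az picard_group_inverse[OF A(1)]] denom_ge_1_region[OF z A(1)] .
  ultimately have d1: "cmod (denom A z) = 1"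
    using mult_left_mono[of 1 "cmod (denom (picard_inverse A) (act A z))" "cmod (denom A z)"] by simp
  \<comment> \<open>Moving \<open>z\<^sub>2\<close> in the direction \<open>w\<close> heads for the
    zero of the affine function \<open>denom A\<close>; the denominator shrinks by the factor
    \<open>1 - t\<close>, against \<open>denom_ge_1_region\<close>.\<close>
  define w where "w = - denom A z / A$1$3"
  define v :: "complex^2" where "v = vector [0, w]"
  obtain e where e: "0 < e" "\<And>t. \<bar>t\<bar> \<le> e \<Longrightarrow> z + t *\<^sub>R v \<in> picard_region {1..8}"
    using ex_line_in_interior[OF int] by blast
  define t where "t = min e 1"
  have t: "0 < t" "t \<le> 1" "\<bar>t\<bar> \<le> e" using e(1) by (auto simp: t_def)
  have "denom A (z + t *\<^sub>R v) = denom A z + t *\<^sub>R (A$1$3 * w)"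
    by (simp add: denom_def v_def algebra_simps)
  also have "\<dots> = of_real (1 - t) * denom A z" using c by (simp add: w_def scaleR_conv_of_real algebra_simps)
  finally have "cmod (denom A (z + t *\<^sub>R v)) = 1 - t" using t d1 by (simp add: norm_mult del: of_real_diff)
  then show False using denom_ge_1_region[OF e(2)[OF t(3)] A(1)] t by simp
qed

section \<open>Necessity of the eight conditions\<close>

lemma region_strict_witness:
  assumes k: "k \<in> {1..8}" and pq: "0 \<le> p" "0 \<le> q" "p + q \<le> 1" "\<bar>x\<bar> \<le> 1/2" "(p\<^sup>2 + q\<^sup>2) / 2 < y"
    and only: "\<forall>j\<in>{1..8}. sphere_condition j p q x y \<longleftrightarrow> j \<noteq> k"
  shows "picard_region {1..8} \<subset> picard_region ({1..8} - {k})"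
proof -
  define z :: "complex^2" where "z = vector [Complex p q, Complex x y]"
  have "z \<in> D2" using pq(5) by (simp add: z_def D2_def cmod_power2)
  then have "z \<in> picard_region ({1..8} - {k})" "z \<notin> picard_region {1..8}"
    using k pq only by (auto simp: picard_region_eq z_def)
  moreover have "picard_region {1..8} \<subseteq> picard_region ({1..8} - {k})" by (auto simp: picard_region_def)
  ultimately show ?thesis by blast
qed

lemma region_strict: "\<forall>k\<in>{1..8}. picard_region {1..8} \<subset> picard_region ({1..8} - {k})"
  unfolding ball_1_8
proof (intro conjI)
  \<comment> \<open>The arguments after the index are \<open>p\<close>, \<open>q\<close>,
    \<open>x\<close>, \<open>y\<close>. For indices 5 to 8 the witness lies vertically above the
    centre of the omitted sphere. For 2 to 4 it lies over the hypotenuse \<open>p + q = 1\<close>,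
    just outside the unit sphere since \<open>1/4 + 49/64 = 65/64\<close>.\<close>
  show "picard_region {1..8} \<subset> picard_region ({1..8} - {1})"
    by (rule region_strict_witness[of 1 0 0 "-1/2" "1/2"], unfold ball_1_8 sphere_condition_def)
       (simp_all add: power2_eq_square)
  show "picard_region {1..8} \<subset> picard_region ({1..8} - {2})"
    by (rule region_strict_witness[of 2 "3/8" "5/8" "1/2" "7/8"], unfold ball_1_8 sphere_condition_def)
       (simp_all add: power2_eq_square)
  show "picard_region {1..8} \<subset> picard_region ({1..8} - {3})"
    by (rule region_strict_witness[of 3 "3/8" "5/8" "-1/2" "7/8"], unfold ball_1_8 sphere_condition_def)
       (simp_all add: power2_eq_square)
  show "picard_region {1..8} \<subset> picard_region ({1..8} - {4})"
    by (rule region_strict_witness[of 4 "5/8" "3/8" "-1/2" "7/8"], unfold ball_1_8 sphere_condition_def)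
       (simp_all add: power2_eq_square)
  show "picard_region {1..8} \<subset> picard_region ({1..8} - {5})"
    by (rule region_strict_witness[of 5 1 0 "1/2" 1], unfold ball_1_8 sphere_condition_def)
       (simp_all add: power2_eq_square)
  show "picard_region {1..8} \<subset> picard_region ({1..8} - {6})"
    by (rule region_strict_witness[of 6 1 0 "-1/2" 1], unfold ball_1_8 sphere_condition_def)
       (simp_all add: power2_eq_square)
  show "picard_region {1..8} \<subset> picard_region ({1..8} - {7})"
    by (rule region_strict_witness[of 7 0 1 "1/2" 1], unfold ball_1_8 sphere_condition_def)
       (simp_all add: power2_eq_square)
  show "picard_region {1..8} \<subset> picard_region ({1..8} - {8})"
    by (rule region_strict_witness[of 8 0 1 "-1/2" 1], unfold ball_1_8 sphere_condition_def)
       (simp_all add: power2_eq_square)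
qed

theorem theorem2:
  shows "(\<forall>j\<in>{1..8}. in_picard (G j))
    \<and> (\<forall>j\<in>{1..4}. has_dilation_parameter (G j) 1)
    \<and> (\<forall>j\<in>{5..8}. has_dilation_parameter (G j) (sqrt 2))
    \<and> fundamental_domain picard_group (picard_region {1..8})
    \<and> (\<forall>k\<in>{1..8}. picard_region {1..8} \<subset> picard_region ({1..8} - {k}))"
proof (intro conjI)
  show "\<forall>j\<in>{1..8}. in_picard (G j)"
    using in_picard_if_given_by G_matrix_picard G_given_by by blast
  have dil: "has_dilation_parameter (G j) (if j \<le> 4 then 1 else sqrt 2)" if "j \<in> {1..8}" for j
    using that G_matrix_picard G_given_by cmod_G_matrix_13
    by (intro has_dilation_parameter_given_by[of "G_matrix j"]) auto
  show "\<forall>j\<in>{1..4}. has_dilation_parameter (G j) 1"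
  proof
    fix j :: nat assume "j \<in> {1..4}"
    then show "has_dilation_parameter (G j) 1" using dil[of j] by simp
  qed
  show "\<forall>j\<in>{5..8}. has_dilation_parameter (G j) (sqrt 2)"
  proof
    fix j :: nat assume "j \<in> {5..8}"
    then show "has_dilation_parameter (G j) (sqrt 2)" using dil[of j] by simp
  qed
  show "fundamental_domain picard_group (picard_region {1..8})"
    unfolding fundamental_domain_def
    using picard_region_subset_D2 ex_act_in_region frontier_if_act_in_region by blast
qed (rule region_strict)

end
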